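(* For every graph $H$, ${\delta_{\text{poly-rem}}}(H)\leq \delta_{\text{hom}}(\mathcal{I}_H)$.
   Context: All graphs are finite and simple; "copies" of $H$ in $G$ are labeled copies (injective maps $V(H)\to V(G)$ sending edges to edges). For a graph $H$, $\varepsilon>0$ and $\gamma\in[0,1]$, let $\delta(\varepsilon,H;\gamma)$ be the maximum $\delta\in[0,1]$ such that every $n$-vertex graph $G$ with minimum degree at least $\gamma n$ which contains $\varepsilon n^2$ edge-disjoint copies of $H$ contains at least $\delta n^{v(H)}$ copies of $H$. The polynomial removal threshold ${\delta_{\text{poly-rem}}}(H)$ is the infimum of those $\gamma$ for which there exists $\mu=\mu(\gamma)>0$ with $\delta(\varepsilon,H;\gamma)\geq\mu\varepsilon^{1/\mu}$ for all $\varepsilon>0$. A graph is $\mathcal{H}$-free for a family $\mathcal{H}$ of graphs if it contains no member of $\mathcal{H}$ as a subgraph. The homomorphism threshold $\delta_{\text{hom}}(\mathcal{H})$ of a family $\mathcal{H}$ is the infimum of those $\gamma$ for which there exists an $\mathcal{H}$-free graph $F=F(\gamma)$ such that every $n$-vertex $\mathcal{H}$-free graph $G$ with minimum degree at least $\gamma n$ admits a graph homomorphism to $F$. $\mathcal{I}_H$ denotes the set of all graphs $H'$ that are minimal with respect to inclusion (subgraph relation) among graphs to which $H$ admits a homomorphism.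
   Formalization: In the polynomial removal threshold, the bound δ(ε,H;γ) ≥ με^{1/μ} is required only for 0<ε≤1, since δ≤1 by definition makes it impossible for all large ε; an infimum over an empty set of γ is taken as infinity. *)

theory Defs
  imports Complex_Main "HOL-Library.FuncSet" "HOL-Library.Extended_Real"
begin

type_synonym 'a graph = "'a set \<times> 'a set set"

abbreviation verts :: "'a graph \<Rightarrow> 'a set" where "verts G \<equiv> fst G"
abbreviation edges :: "'a graph \<Rightarrow> 'a set set" where "edges G \<equiv> snd G"

definition simple_graph :: "'a graph \<Rightarrow> bool" where
  "simple_graph G \<longleftrightarrow> finite (verts G) \<and> (\<forall>e\<in>edges G. e \<subseteq> verts G \<and> card e = 2)"

definition vdegree :: "'a graph \<Rightarrow> 'a \<Rightarrow> nat" where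
  "vdegree G v = card {e \<in> edges G. v \<in> e}"

definition min_degree_at_least :: "'a graph \<Rightarrow> real \<Rightarrow> bool" where
  "min_degree_at_least G d \<longleftrightarrow> (\<forall>v\<in>verts G. real (vdegree G v) \<ge> d)"

text \<open>The condition \<open>f ` e \<in> edges F\<close> forces adjacent vertices to have distinct images, because
  every edge of a simple graph \<open>F\<close> has two elements.\<close>

definition graph_hom :: "('a \<Rightarrow> 'b) \<Rightarrow> 'a graph \<Rightarrow> 'b graph \<Rightarrow> bool" where
  "graph_hom f G F \<longleftrightarrow> f ` verts G \<subseteq> verts F \<and> (\<forall>e\<in>edges G. f ` e \<in> edges F)"

definition admits_hom :: "'a graph \<Rightarrow> 'b graph \<Rightarrow> bool" where
  "admits_hom G F \<longleftrightarrow> (\<exists>f. graph_hom f G F)"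

text \<open>Labeled copies are taken as extensional functions, so that each one is counted once.\<close>

definition copies :: "'a graph \<Rightarrow> 'b graph \<Rightarrow> ('a \<Rightarrow> 'b) set" where
  "copies H G = {f \<in> verts H \<rightarrow>\<^sub>E verts G. inj_on f (verts H) \<and> graph_hom f H G}"

definition edge_disjoint_copies :: "'a graph \<Rightarrow> ('a \<Rightarrow> 'b) set \<Rightarrow> bool" where
  "edge_disjoint_copies H C \<longleftrightarrow>
     (\<forall>f\<in>C. \<forall>g\<in>C. f \<noteq> g \<longrightarrow> ((`) f ` edges H) \<inter> ((`) g ` edges H) = {})"

definition contains_edge_disjoint_copies :: "'b graph \<Rightarrow> 'a graph \<Rightarrow> real \<Rightarrow> bool" where
  "contains_edge_disjoint_copies G H x \<longleftrightarrow>
     (\<exists>C \<subseteq> copies H G. edge_disjoint_copies H C \<and> real (card C) \<ge> x)"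

text \<open>Host graphs (and the targets of homomorphisms below) have natural numbers as vertices; every
  finite graph is isomorphic to such a graph.\<close>

definition removal_admissible :: "real \<Rightarrow> 'a graph \<Rightarrow> real \<Rightarrow> real \<Rightarrow> bool" where
  "removal_admissible \<epsilon> H \<gamma> \<delta> \<longleftrightarrow> 0 \<le> \<delta> \<and> \<delta> \<le> 1 \<and>
     (\<forall>(G :: nat graph) n. simple_graph G \<and> card (verts G) = n \<and>
        min_degree_at_least G (\<gamma> * real n) \<and>
        contains_edge_disjoint_copies G H (\<epsilon> * real n ^ 2) \<longrightarrow>
        real (card (copies H G)) \<ge> \<delta> * real n ^ card (verts H))"

definition removal_delta :: "real \<Rightarrow> 'a graph \<Rightarrow> real \<Rightarrow> real" where
  "removal_delta \<epsilon> H \<gamma> = (GREATEST \<delta>. removal_admissible \<epsilon> H \<gamma> \<delta>)"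

lemma removal_delta_is_max:
  "removal_admissible \<epsilon> H \<gamma> (removal_delta \<epsilon> H \<gamma>)"
  "removal_admissible \<epsilon> H \<gamma> \<delta> \<Longrightarrow> \<delta> \<le> removal_delta \<epsilon> H \<gamma>"
proof -
  define S where "S = {\<delta>. removal_admissible \<epsilon> H \<gamma> \<delta>}"
  have S0: "0 \<in> S" by (simp add: S_def removal_admissible_def)
  have bdd: "bdd_above S" by (auto simp: S_def removal_admissible_def intro!: bdd_aboveI[of _ 1])
  have up: "x \<le> Sup S" if "x \<in> S" for x using that bdd by (rule cSup_upper)
  have le1: "x \<le> 1" if "x \<in> S" for x using that by (simp add: S_def removal_admissible_def)
  have "Sup S \<le> 1" using S0 le1 by (intro cSup_least) auto
  moreover have "Sup S * real n ^ card (verts H) \<le> real (card (copies H G))"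
    if G: "simple_graph G" "card (verts G) = n" "min_degree_at_least G (\<gamma> * real n)"
      "contains_edge_disjoint_copies G H (\<epsilon> * real n ^ 2)" for G :: "nat graph" and n
  proof (cases "real n ^ card (verts H) = 0")
    case False
    then have pos: "real n ^ card (verts H) > 0"
      by (metis of_nat_0_le_iff order_le_less zero_le_power)
    have "Sup S \<le> real (card (copies H G)) / real n ^ card (verts H)"
    proof (rule cSup_least)
      show "x \<le> real (card (copies H G)) / real n ^ card (verts H)" if "x \<in> S" for x
      proof -
        have "x * real n ^ card (verts H) \<le> real (card (copies H G))"
          using that G unfolding S_def removal_admissible_def by blast
        then show ?thesis using pos by (simp add: pos_le_divide_eq)
      qed
    qed (use S0 in auto)
    then show ?thesis using pos by (simp add: pos_le_divide_eq)
  next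
    case True
    show ?thesis unfolding True by simp
  qed
  ultimately have adm: "removal_admissible \<epsilon> H \<gamma> (Sup S)"
    using up[OF S0] unfolding removal_admissible_def by blast
  have eq: "removal_delta \<epsilon> H \<gamma> = Sup S"
    unfolding removal_delta_def
    by (rule Greatest_equality) (use adm up in \<open>auto simp: S_def\<close>)
  show "removal_admissible \<epsilon> H \<gamma> (removal_delta \<epsilon> H \<gamma>)" using adm eq by simp
  show "removal_admissible \<epsilon> H \<gamma> \<delta> \<Longrightarrow> \<delta> \<le> removal_delta \<epsilon> H \<gamma>"
    using up eq by (simp add: S_def)
qed

text \<open>The polynomial bound is required for \<open>0 < \<epsilon> \<le> 1\<close>: since \<open>removal_delta\<close> never exceeds 1, no
  \<open>\<mu>\<close> could satisfy it for arbitrarily large \<open>\<epsilon>\<close>. Thresholds are extended reals, so that the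
  infimum of an empty set of densities is \<open>\<infinity>\<close>.\<close>

definition poly_rem_threshold :: "'a graph \<Rightarrow> ereal" where
  "poly_rem_threshold H = Inf (ereal ` {\<gamma>. 0 \<le> \<gamma> \<and> \<gamma> \<le> 1 \<and>
     (\<exists>\<mu>>0. \<forall>\<epsilon>. 0 < \<epsilon> \<and> \<epsilon> \<le> 1 \<longrightarrow> removal_delta \<epsilon> H \<gamma> \<ge> \<mu> * \<epsilon> powr (1 / \<mu>))})"

definition family_free :: "'a graph set \<Rightarrow> 'b graph \<Rightarrow> bool" where
  "family_free \<H> G \<longleftrightarrow> (\<forall>H\<in>\<H>. copies H G = {})"

definition hom_threshold :: "'a graph set \<Rightarrow> ereal" where
  "hom_threshold \<H> = Inf (ereal ` {\<gamma>. 0 \<le> \<gamma> \<and> \<gamma> \<le> 1 \<and>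
     (\<exists>F :: nat graph. simple_graph F \<and> family_free \<H> F \<and>
        (\<forall>(G :: nat graph) n. simple_graph G \<and> card (verts G) = n \<and> family_free \<H> G \<and>
           min_degree_at_least G (\<gamma> * real n) \<longrightarrow> admits_hom G F))})"

definition subgraph_of :: "'a graph \<Rightarrow> 'a graph \<Rightarrow> bool" where
  "subgraph_of K G \<longleftrightarrow> verts K \<subseteq> verts G \<and> edges K \<subseteq> edges G"

definition minimal_hom_images :: "'a graph \<Rightarrow> nat graph set" where
  "minimal_hom_images H = {H'. simple_graph H' \<and> admits_hom H H' \<and>
     (\<forall>K. simple_graph K \<and> admits_hom H K \<and> subgraph_of K H' \<longrightarrow> K = H')}"

end

theory Submission imports Defs "HOL-Analysis.Convex" begin

text \<open>Let \<open>\<gamma>0\<close> be a density admissible for the homomorphism threshold, with target \<open>F\<close>, and let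
  \<open>\<gamma> > \<gamma>0\<close>. A graph \<open>G\<close> with minimum degree \<open>\<gamma> n\<close> and \<open>\<epsilon> n\<^sup>2\<close> edge-disjoint copies of \<open>H\<close> is
  \<open>\<epsilon>\<close>-far from mapping to \<open>F\<close>, because \<open>H\<close> does not map to \<open>F\<close>. Mapping to \<open>F\<close> is testable with
  polynomially many queries: a sequence of \<open>s = O(1 / \<epsilon>\<^sup>2)\<close> random vertices, with repetitions,
  induces on its index set \<open>{..<s}\<close> a graph that most likely does not map to \<open>F\<close> and has minimum
  degree at least \<open>\<gamma>0 s\<close>. Hence this graph is not free of the minimal images of \<open>H\<close>, that is, \<open>H\<close>
  maps to it. One map \<open>h\<close> from \<open>H\<close> to the indices thus works for a polynomial proportion of the
  sequences. Separating the vertices of \<open>H\<close> identified by \<open>h\<close> one at a time by Cauchy-Schwarz gives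
  polynomially many homomorphisms from \<open>H\<close> to \<open>G\<close>; most of them are injective once \<open>n\<close> is large,
  and for small \<open>n\<close> a single copy of \<open>H\<close> suffices.\<close>

subsection \<open>Testing list colourability\<close>

lemma sum_PiE_insert:
  fixes \<phi> :: "('i \<Rightarrow> 'v) \<Rightarrow> 'b::comm_monoid_add"
  assumes "i \<notin> J"
  shows "(\<Sum>f\<in>insert i J \<rightarrow>\<^sub>E V. \<phi> f) = (\<Sum>u\<in>V. \<Sum>g\<in>J \<rightarrow>\<^sub>E V. \<phi> (g(i := u)))"
proof -
  have "(\<Sum>f\<in>insert i J \<rightarrow>\<^sub>E V. \<phi> f) = (\<Sum>(u, g)\<in>V \<times> (J \<rightarrow>\<^sub>E V). \<phi> (g(i := u)))"
    unfolding PiE_insert_eq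
    by (subst sum.reindex) (auto intro!: inj_combinator assms sum.cong simp: o_def)
  then show ?thesis by (simp add: sum.cartesian_product)
qed

lemma card_filter_eq_sum:
  "finite A \<Longrightarrow> card {x \<in> A. P x} = (\<Sum>x\<in>A. if P x then 1 else 0)"
  using sum.inter_filter[of A "\<lambda>_. 1::nat" P] by simp

lemma card_filter_PiE_insert:
  assumes "i \<notin> J" "finite J" "finite V"
  shows "card {f \<in> insert i J \<rightarrow>\<^sub>E V. P f} = (\<Sum>u\<in>V. card {g \<in> J \<rightarrow>\<^sub>E V. P (g(i := u))})"
  using assms by (simp add: finite_PiE card_filter_eq_sum sum_PiE_insert)

text \<open>\<open>A\<close> is adjacency in the host graph and \<open>B\<close> in the target.
  Colours belong to indices rather than vertices, so a vertex sampled twice may receive two colours.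
  When every list is the full vertex set of the target, this says that the graph induced on the
  indices maps to it.\<close>

definition list_colourable ::
  "('v \<Rightarrow> 'v \<Rightarrow> bool) \<Rightarrow> ('c \<Rightarrow> 'c \<Rightarrow> bool) \<Rightarrow> ('v \<Rightarrow> 'c set) \<Rightarrow> 'i set \<Rightarrow> ('i \<Rightarrow> 'v) \<Rightarrow> bool" where
  "list_colourable A B L J f \<longleftrightarrow>
     (\<exists>c. (\<forall>j\<in>J. c j \<in> L (f j)) \<and> (\<forall>i\<in>J. \<forall>j\<in>J. A (f i) (f j) \<longrightarrow> B (c i) (c j)))"

text \<open>The lists that remain once a sampled vertex \<open>u\<close> has been coloured
  \<open>a\<close>. Passing to them lets an induction over the indices forget
  \<open>u\<close>.\<close>

definition restrict_lists ::
  "('v \<Rightarrow> 'v \<Rightarrow> bool) \<Rightarrow> ('c \<Rightarrow> 'c \<Rightarrow> bool) \<Rightarrow> ('v \<Rightarrow> 'c set) \<Rightarrow> 'v \<Rightarrow> 'c \<Rightarrow> 'v \<Rightarrow> 'c set" where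
  "restrict_lists A B L u a = (\<lambda>w. if A u w then {b \<in> L w. B a b} else L w)"

lemma restrict_lists_subset: "restrict_lists A B L u a w \<subseteq> L w"
  by (simp add: restrict_lists_def)

text \<open>A vertex with an empty list is heavy.\<close>

definition heavy ::
  "('v \<Rightarrow> 'v \<Rightarrow> bool) \<Rightarrow> ('c \<Rightarrow> 'c \<Rightarrow> bool) \<Rightarrow> ('v \<Rightarrow> 'c set) \<Rightarrow> 'v set \<Rightarrow> real \<Rightarrow> 'v \<Rightarrow> bool" where
  "heavy A B L V r u \<longleftrightarrow>
     (\<forall>a\<in>L u. real (\<Sum>w\<in>V. card (restrict_lists A B L u a w)) + r \<le> real (\<Sum>w\<in>V. card (L w)))"

lemma list_colourable_subset:
  "list_colourable A B L J f \<Longrightarrow> I \<subseteq> J \<Longrightarrow> list_colourable A B L I f"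
  unfolding list_colourable_def by blast

lemma list_colourable_cong:
  "(\<And>j. j \<in> J \<Longrightarrow> f j = g j) \<Longrightarrow> list_colourable A B L J f \<longleftrightarrow> list_colourable A B L J g"
  unfolding list_colourable_def by simp

text \<open>The witness is the colour that the given colouring assigns to index \<open>i\<close>:
  the constraints between \<open>i\<close> and \<open>J\<close> are absorbed into the shortened
  lists, and those inside \<open>J\<close> persist.\<close>

lemma list_colourable_insert_upd:
  assumes "list_colourable A B L (insert i J) (g(i := u))" "i \<notin> J"
  obtains a where "a \<in> L u" "list_colourable A B (restrict_lists A B L u a) J g"
proof -
  obtain c where c: "\<forall>j\<in>insert i J. c j \<in> L ((g(i := u)) j)"
    "\<forall>k\<in>insert i J. \<forall>j\<in>insert i J. A ((g(i := u)) k) ((g(i := u)) j) \<longrightarrow> B (c k) (c j)"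
    using assms unfolding list_colourable_def by blast
  have ne: "j \<noteq> i" if "j \<in> J" for j using that assms by auto
  have "list_colourable A B (restrict_lists A B L u (c i)) J g"
    unfolding list_colourable_def
  proof (intro exI[of _ c] conjI ballI impI)
    fix j assume j: "j \<in> J"
    have "c j \<in> L (g j)" using bspec[OF c(1), of j] j ne[OF j] by simp
    moreover have "A u (g j) \<longrightarrow> B (c i) (c j)"
      using bspec[OF bspec[OF c(2), of i], of j] j ne[OF j] by simp
    ultimately show "c j \<in> restrict_lists A B L u (c i) (g j)"
      by (simp add: restrict_lists_def)
  next
    fix k j assume "k \<in> J" "j \<in> J" "A (g k) (g j)"
    then show "B (c k) (c j)"
      using bspec[OF bspec[OF c(2), of k], of j] ne by simp
  qed
  moreover have "c i \<in> L u" using c(1) by simp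
  ultimately show ?thesis using that by blast
qed

text \<open>Otherwise colour each light vertex by a colour witnessing that it is light: a pair of light
  vertices is then coloured wrongly only if the first one shortens the list of the second.\<close>

lemma many_heavy:
  assumes fin: "finite V" "finite W" "V \<noteq> {}" "W \<noteq> {}"
    and L: "\<And>v. v \<in> V \<Longrightarrow> L v \<subseteq> W"
    and far: "\<And>\<phi>. \<phi> ` V \<subseteq> W \<Longrightarrow>
      \<epsilon> * real (card V) ^ 2 \<le> real (card {(u, w) \<in> V \<times> V. A u w \<and> \<not> B (\<phi> u) (\<phi> w)})"
  shows "\<epsilon> / 3 * real (card V) \<le> real (card {u \<in> V. heavy A B L V (\<epsilon> / 3 * real (card V)) u})"
proof (rule ccontr)
  define n where "n = real (card V)"
  define r where "r = \<epsilon> / 3 * n"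
  define X where "X = {u \<in> V. heavy A B L V r u}"
  assume "\<not> ?thesis"
  then have X: "real (card X) < r" by (simp add: X_def r_def n_def)
  have finX: "finite X" using fin by (simp add: X_def)
  have n: "n > 0" using fin by (simp add: n_def card_gt_0_iff)
  obtain w0 where w0: "w0 \<in> W" using fin by blast
  have "\<exists>a. a \<in> L u \<and> real (\<Sum>w\<in>V. card (L w)) < real (\<Sum>w\<in>V. card (restrict_lists A B L u a w)) + r"
    if "u \<in> V - X" for u
    using that unfolding X_def heavy_def by force
  then obtain c where c: "\<And>u. u \<in> V - X \<Longrightarrow> c u \<in> L u"
    "\<And>u. u \<in> V - X \<Longrightarrow>
       real (\<Sum>w\<in>V. card (L w)) < real (\<Sum>w\<in>V. card (restrict_lists A B L u (c u) w)) + r"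
    by metis
  \<comment> \<open>Heavy vertices get the arbitrary colour \<open>w0\<close>. The wrong pairs
    meeting them are simply bounded by the number of all pairs meeting \<open>X\<close>.\<close>
  define \<phi> where "\<phi> u = (if u \<in> V - X then c u else w0)" for u
  define S where "S = {(u, w) \<in> V \<times> V. A u w \<and> \<not> B (\<phi> u) (\<phi> w)}"
  define N where "N u = {w \<in> V - X. A u w \<and> \<not> B (\<phi> u) (\<phi> w)}" for u
  have "\<phi> ` V \<subseteq> W" using c L w0 by (fastforce simp: \<phi>_def)
  then have lower: "\<epsilon> * n ^ 2 \<le> real (card S)" using far unfolding S_def n_def by blast
  have N: "real (card (N u)) \<le> r" if u: "u \<in> V - X" for u
  proof -
    have finL: "finite (L w)" if "w \<in> V" for w using L[OF that] fin finite_subset by blast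
    \<comment> \<open>Each \<open>w\<close> in \<open>N u\<close> loses at least the colour
      \<open>c w\<close> from its list, so \<open>card (N u)\<close> is at most the total
      shortening, which is less than \<open>r\<close> because \<open>u\<close> is light.\<close>
    have "card (restrict_lists A B L u (c u) w) + (if w \<in> N u then 1 else 0) \<le> card (L w)"
      if w: "w \<in> V" for w
    proof (cases "w \<in> N u")
      case True
      then have w': "w \<in> V - X" "A u w" "\<not> B (c u) (c w)" using u by (auto simp: N_def \<phi>_def)
      have "c w \<in> L w" by (rule c(1)[OF w'(1)])
      moreover have "c w \<notin> restrict_lists A B L u (c u) w"
        using w' by (simp add: restrict_lists_def)
      ultimately have "restrict_lists A B L u (c u) w \<subset> L w"
        using restrict_lists_subset[of A B L u "c u" w] by auto
      then have "card (restrict_lists A B L u (c u) w) < card (L w)"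
        by (rule psubset_card_mono[OF finL[OF w]])
      then show ?thesis using True by simp
    next
      case False
      then show ?thesis using card_mono[OF finL[OF w] restrict_lists_subset[of A B L u "c u" w]] by simp
    qed
    then have "(\<Sum>w\<in>V. card (restrict_lists A B L u (c u) w) + (if w \<in> N u then 1 else 0))
      \<le> (\<Sum>w\<in>V. card (L w))"
      by (rule sum_mono)
    moreover have "(\<Sum>w\<in>V. if w \<in> N u then 1 else 0) = card (N u)"
    proof -
      have "V \<inter> N u = N u" by (auto simp: N_def)
      then show ?thesis using fin by (simp add: sum.If_cases)
    qed
    ultimately have "(\<Sum>w\<in>V. card (restrict_lists A B L u (c u) w)) + card (N u) \<le> (\<Sum>w\<in>V. card (L w))"
      by (simp add: sum.distrib)
    then show ?thesis using c(2)[OF u] by linarith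
  qed
  have "S \<subseteq> X \<times> V \<union> V \<times> X \<union> (SIGMA u:V - X. N u)"
    by (auto simp: S_def N_def)
  moreover have finN: "finite (N u)" for u using fin by (simp add: N_def)
  ultimately have "card S \<le> card (X \<times> V \<union> V \<times> X \<union> (SIGMA u:V - X. N u))"
    using fin finX by (intro card_mono) auto
  also have "\<dots> \<le> card (X \<times> V) + card (V \<times> X) + card (SIGMA u:V - X. N u)"
    by (intro order.trans[OF card_Un_le] add_mono card_Un_le order.refl)
  also have "card (SIGMA u:V - X. N u) = (\<Sum>u\<in>V - X. card (N u))"
    using fin finN by simp
  finally have "real (card S) \<le> real (card X) * n + n * real (card X) + (\<Sum>u\<in>V - X. real (card (N u)))"
    by (simp add: card_cartesian_product n_def flip: of_nat_sum of_nat_mult of_nat_add)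
  also have "(\<Sum>u\<in>V - X. real (card (N u))) \<le> real (card (V - X)) * r"
    using sum_bounded_above[of "V - X" "\<lambda>u. real (card (N u))" r] N by simp
  also have "\<dots> \<le> n * r"
    using X fin by (intro mult_right_mono) (auto simp: n_def intro!: card_mono)
  \<comment> \<open>Heavy first vertices, heavy second vertices and light pairs contribute at most
    \<open>n * r\<close> each; hence the choice of \<open>r\<close> as one third of
    \<open>\<epsilon> * n\<close>.\<close>
  finally have "real (card S) \<le> 2 * (n * real (card X)) + n * r" by simp
  also have "\<dots> < 2 * (n * r) + n * r" using X n by simp
  also have "\<dots> = \<epsilon> * n ^ 2" by (simp add: r_def power2_eq_square)
  finally show False using lower by simp
qed

text \<open>Only a heavy vertex is charged for its colour: it has at most \<open>card W\<close> colours and each of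
  them lowers the exponent by one, so it halves the bound.\<close>

lemma card_list_colourable_le:
  fixes V :: "'v set" and W :: "'c set" and J :: "'i set" and \<epsilon> :: real
  assumes fin: "finite V" "finite W" "V \<noteq> {}" "W \<noteq> {}" "finite J"
    and eps: "0 < \<epsilon>" "\<epsilon> \<le> 1"
    and L: "\<And>v. v \<in> V \<Longrightarrow> L v \<subseteq> W"
    and far: "\<And>\<phi>. \<phi> ` V \<subseteq> W \<Longrightarrow>
      \<epsilon> * real (card V) ^ 2 \<le> real (card {(u, w) \<in> V \<times> V. A u w \<and> \<not> B (\<phi> u) (\<phi> w)})"
  shows "real (card {f \<in> J \<rightarrow>\<^sub>E V. list_colourable A B L J f}) \<le>
    real (card V) ^ card J *
    (2 * real (card W)) powr (real (\<Sum>v\<in>V. card (L v)) / (\<epsilon> / 3 * real (card V))) * (1 - \<epsilon> / 6) ^ card J"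
proof -
  have cW: "card W \<ge> 1" using fin by (simp add: Suc_le_eq card_gt_0_iff)
  show ?thesis
    using fin(5) L
  proof (induction J arbitrary: L rule: finite_induct)
    case empty
    have "{f :: 'i \<Rightarrow> 'v. f \<in> {} \<rightarrow>\<^sub>E V \<and> list_colourable A B L {} f} \<subseteq> {\<lambda>_. undefined}" by auto
    then have "card {f :: 'i \<Rightarrow> 'v. f \<in> {} \<rightarrow>\<^sub>E V \<and> list_colourable A B L {} f} \<le> card {\<lambda>_::'i. undefined::'v}"
      by (intro card_mono) auto
    then have "real (card {f :: 'i \<Rightarrow> 'v. f \<in> {} \<rightarrow>\<^sub>E V \<and> list_colourable A B L {} f}) \<le> 1" by simp
    \<comment> \<open>The only function on the empty index set counts 1, and the bound is at least 1
      because its exponent is nonnegative.\<close>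
    also have "1 \<le> (2 * real (card W)) powr (real (\<Sum>v\<in>V. card (L v)) / (\<epsilon> / 3 * real (card V)))"
    proof (rule ge_one_powr_ge_zero)
      show "1 \<le> 2 * real (card W)" using cW by simp
      show "0 \<le> real (\<Sum>v\<in>V. card (L v)) / (\<epsilon> / 3 * real (card V))"
        using eps by (intro divide_nonneg_nonneg mult_nonneg_nonneg of_nat_0_le_iff) auto
    qed
    finally show ?case by simp
  next
    case (insert i J)
    define n where "n = real (card V)"
    define r where "r = \<epsilon> / 3 * n"
    \<comment> \<open>A union bound over at most \<open>card W\<close> colours, each gaining a
      factor \<open>1 / K\<close>, yields the factor 1/2 for heavy vertices.\<close>
    define K where "K = 2 * real (card W)"
    define \<Phi> where "\<Phi> M = real (\<Sum>v\<in>V. card (M v :: 'c set)) / r" for M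
    define X where "X = n ^ card J * K powr \<Phi> L * (1 - \<epsilon> / 6) ^ card J"
    define Y where "Y = {u \<in> V. heavy A B L V r u}"
    have n: "n > 0" using fin by (simp add: n_def card_gt_0_iff)
    then have r: "r > 0" using eps by (simp add: r_def)
    have K: "K > 1" using cW by (simp add: K_def)
    have finP: "finite (J \<rightarrow>\<^sub>E V)" using insert.hyps fin by (simp add: finite_PiE)
    have IH: "real (card {f \<in> J \<rightarrow>\<^sub>E V. list_colourable A B M J f})
        \<le> n ^ card J * K powr \<Phi> M * (1 - \<epsilon> / 6) ^ card J" if "\<And>v. v \<in> V \<Longrightarrow> M v \<subseteq> W" for M
      using insert.IH[OF that] by (simp add: n_def r_def K_def \<Phi>_def)
    have X0: "X \<ge> 0" unfolding X_def using n eps by simp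
    define N where "N u = real (card {g \<in> J \<rightarrow>\<^sub>E V. list_colourable A B L (insert i J) (g(i := u))})" for u
    \<comment> \<open>For an arbitrary first vertex the index \<open>i\<close> is dropped and the
      lists are left unchanged.\<close>
    have light: "N u \<le> X" for u
    proof -
      have "list_colourable A B L J g" if "list_colourable A B L (insert i J) (g(i := u))" for g
      proof -
        have "list_colourable A B L J (g(i := u))" using that list_colourable_subset by blast
        moreover have "\<And>j. j \<in> J \<Longrightarrow> (g(i := u)) j = g j" using insert.hyps by auto
        ultimately show ?thesis using list_colourable_cong[of J "g(i := u)" g] by blast
      qed
      then have "N u \<le> real (card {f \<in> J \<rightarrow>\<^sub>E V. list_colourable A B L J f})"
        unfolding N_def using finP by (intro of_nat_mono card_mono) auto
      also have "\<dots> \<le> X" unfolding X_def by (rule IH[OF insert.prems])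
      finally show ?thesis .
    qed
    have hvy: "N u \<le> X / 2" if u: "u \<in> Y" for u
    proof -
      have uV: "u \<in> V" using u by (simp add: Y_def)
      have finL: "finite (L u)" using insert.prems[OF uV] fin finite_subset by blast
      let ?M = "restrict_lists A B L u"
      have each: "real (card {f \<in> J \<rightarrow>\<^sub>E V. list_colourable A B (?M a) J f}) \<le> X / K"
        if a: "a \<in> L u" for a
      proof -
        have "real (\<Sum>w\<in>V. card (?M a w)) + r \<le> real (\<Sum>w\<in>V. card (L w))"
          using u a by (simp add: Y_def heavy_def)
        then have "(real (\<Sum>w\<in>V. card (?M a w)) + r) / r \<le> \<Phi> L"
          unfolding \<Phi>_def using r by (intro divide_right_mono) auto
        then have "\<Phi> (?M a) \<le> \<Phi> L - 1" using r by (simp add: \<Phi>_def add_divide_distrib)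
        then have "K powr \<Phi> (?M a) \<le> K powr (\<Phi> L - 1)" using K by simp
        also have "\<dots> = K powr \<Phi> L / K" using K by (simp add: powr_diff)
        finally have le: "K powr \<Phi> (?M a) \<le> K powr \<Phi> L / K" .
        have "?M a v \<subseteq> W" if "v \<in> V" for v
          using insert.prems[OF that] by (auto simp: restrict_lists_def)
        then have "real (card {f \<in> J \<rightarrow>\<^sub>E V. list_colourable A B (?M a) J f})
            \<le> n ^ card J * K powr \<Phi> (?M a) * (1 - \<epsilon> / 6) ^ card J"
          by (rule IH)
        also have "\<dots> \<le> n ^ card J * (K powr \<Phi> L / K) * (1 - \<epsilon> / 6) ^ card J"
          using le n eps by (intro mult_right_mono mult_left_mono) auto
        finally show ?thesis by (simp add: X_def)
      qed
      have "{g \<in> J \<rightarrow>\<^sub>E V. list_colourable A B L (insert i J) (g(i := u))}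
        \<subseteq> (\<Union>a\<in>L u. {f \<in> J \<rightarrow>\<^sub>E V. list_colourable A B (?M a) J f})"
        using insert.hyps by (auto elim: list_colourable_insert_upd)
      then have "card {g \<in> J \<rightarrow>\<^sub>E V. list_colourable A B L (insert i J) (g(i := u))}
        \<le> card (\<Union>a\<in>L u. {f \<in> J \<rightarrow>\<^sub>E V. list_colourable A B (?M a) J f})"
        using finP finL by (intro card_mono) auto
      also have "\<dots> \<le> (\<Sum>a\<in>L u. card {f \<in> J \<rightarrow>\<^sub>E V. list_colourable A B (?M a) J f})"
        by (rule card_UN_le[OF finL])
      finally have "N u \<le> (\<Sum>a\<in>L u. real (card {f \<in> J \<rightarrow>\<^sub>E V. list_colourable A B (?M a) J f}))"
        unfolding N_def by (simp flip: of_nat_sum)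
      also have "\<dots> \<le> real (card (L u)) * (X / K)"
        using sum_bounded_above[of "L u" "\<lambda>a. real (card {f \<in> J \<rightarrow>\<^sub>E V. list_colourable A B (?M a) J f})" "X / K"]
          each by simp
      also have "\<dots> \<le> real (card W) * (X / K)"
        using X0 K fin insert.prems[OF uV] by (intro mult_right_mono) (auto intro!: card_mono)
      also have "\<dots> = X / 2" using cW by (simp add: K_def)
      finally show ?thesis .
    qed
    have Y: "r \<le> real (card Y)"
      unfolding Y_def r_def n_def using fin insert.prems far by (intro many_heavy[where W = W]) auto
    have YV: "Y \<subseteq> V" by (auto simp: Y_def)
    then have finY: "finite Y" using fin finite_subset by blast
    have cYV: "real (card (V - Y)) = n - real (card Y)"
      using YV fin finY by (simp add: n_def card_Diff_subset card_mono)
    have "real (card {f \<in> insert i J \<rightarrow>\<^sub>E V. list_colourable A B L (insert i J) f}) = (\<Sum>u\<in>V. N u)"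
      using insert.hyps fin by (simp add: card_filter_PiE_insert N_def)
    also have "\<dots> = (\<Sum>u\<in>V - Y. N u) + (\<Sum>u\<in>Y. N u)"
      using YV fin by (simp add: sum.subset_diff)
    also have "\<dots> \<le> real (card (V - Y)) * X + real (card Y) * (X / 2)"
      using sum_bounded_above[of "V - Y" N X] sum_bounded_above[of Y N "X / 2"] light hvy
      by (intro add_mono) auto
    \<comment> \<open>At least \<open>r\<close> of the \<open>n\<close> choices are heavy and count
      half, so one index costs a factor of at most \<open>n - r / 2\<close>, which is
      \<open>n * (1 - \<epsilon> / 6)\<close>.\<close>
    also have "\<dots> = X * (n - real (card Y) / 2)"
      unfolding cYV by (simp add: algebra_simps)
    also have "\<dots> \<le> X * (n - r / 2)" using Y X0 by (intro mult_left_mono) auto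
    also have "\<dots> = n ^ card (insert i J) * K powr \<Phi> L * (1 - \<epsilon> / 6) ^ card (insert i J)"
      using insert.hyps by (simp add: X_def r_def algebra_simps)
    finally show ?case by (simp add: n_def r_def K_def \<Phi>_def)
  qed
qed

subsection \<open>Minimum degree of a random sample\<close>

text \<open>A Chernoff bound by exponential moments. Fix the vertex at index \<open>i\<close> and
  weight a sample by \<open>x\<close> to the number of other indices adjacent to it. Too few
  neighbours make this weight exceed \<open>x powr (\<gamma>0 * s)\<close>, whereas the sum of the
  weights factorizes over the remaining \<open>s - 1\<close> indices. The leading factor
  \<open>s\<close> is the union bound over \<open>i\<close>.\<close>

lemma card_low_degree_le:
  fixes V :: "'v set" and x \<gamma> \<gamma>0 :: real and s :: nat
  assumes fin: "finite V" and x: "0 < x" "x < 1" and g1: "\<gamma> \<le> 1"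
    and deg: "\<And>u. u \<in> V \<Longrightarrow> \<gamma> * real (card V) \<le> real (card {w \<in> V. A u w})"
  shows "real (card {f \<in> {..<s} \<rightarrow>\<^sub>E V. \<exists>i<s. real (card {j. j < s \<and> A (f i) (f j)}) < \<gamma>0 * real s})
    \<le> real s * (real (card V) ^ s * (x powr (- \<gamma>0 * real s) * (1 - \<gamma> + \<gamma> * x) ^ (s - 1)))"
proof -
  define n where "n = real (card V)"
  define low where "low f i \<longleftrightarrow> real (card {j. j < s \<and> A (f i) (f j)}) < \<gamma>0 * real s" for f :: "nat \<Rightarrow> 'v" and i
  define C where "C = x powr (- \<gamma>0 * real s)"
  have C: "C > 0" using x by (simp add: C_def)
  have each: "real (card {f \<in> {..<s} \<rightarrow>\<^sub>E V. low f i}) \<le> n ^ s * (C * (1 - \<gamma> + \<gamma> * x) ^ (s - 1))"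
    if i: "i < s" for i
  proof -
    define J where "J = {..<s} - {i}"
    have J: "insert i J = {..<s}" "i \<notin> J" "finite J" "card J = s - 1"
      using i by (auto simp: J_def)
    have finJ: "finite (J \<rightarrow>\<^sub>E V)" using fin J by (simp add: finite_PiE)
    have u: "real (card {g \<in> J \<rightarrow>\<^sub>E V. low (g(i := u)) i}) \<le> C * (n * (1 - \<gamma> + \<gamma> * x)) ^ (s - 1)"
      if u: "u \<in> V" for u
    proof -
      have pw: "(\<Prod>j\<in>J. if A u (g j) then x else 1) = x ^ card {j \<in> J. A u (g j)}" for g
        using prod.inter_filter[of J "\<lambda>_. x" "\<lambda>j. A u (g j)"] J by simp
      \<comment> \<open>Markov's inequality pointwise: since \<open>x < 1\<close>, a degree below
        \<open>\<gamma>0 * s\<close> makes the right-hand side at least 1.\<close>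
      have ind: "(if low (g(i := u)) i then 1 else 0) \<le> C * (\<Prod>j\<in>J. if A u (g j) then x else 1)" for g
      proof (cases "low (g(i := u)) i")
        case True
        have "card {j \<in> J. A u (g j)} \<le> card {j. j < s \<and> A ((g(i := u)) i) ((g(i := u)) j)}"
          by (intro card_mono) (auto simp: J_def)
        then have "real (card {j \<in> J. A u (g j)}) < \<gamma>0 * real s"
          using True unfolding low_def by linarith
        then have "x powr (\<gamma>0 * real s) \<le> x powr real (card {j \<in> J. A u (g j)})"
          using x by (intro powr_mono') auto
        then have "C * x powr (\<gamma>0 * real s) \<le> C * x ^ card {j \<in> J. A u (g j)}"
          using C x by (simp add: powr_realpow)
        moreover have "C * x powr (\<gamma>0 * real s) = 1"
          using x by (simp add: C_def powr_minus)
        ultimately show ?thesis using True by (simp add: pw)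
      qed (use C x in \<open>simp add: pw\<close>)
      have "real (card {g \<in> J \<rightarrow>\<^sub>E V. low (g(i := u)) i}) = (\<Sum>g\<in>J \<rightarrow>\<^sub>E V. if low (g(i := u)) i then 1 else 0)"
        using finJ by (simp add: card_filter_eq_sum if_distrib[of real] cong: if_cong)
      also have "\<dots> \<le> (\<Sum>g\<in>J \<rightarrow>\<^sub>E V. C * (\<Prod>j\<in>J. if A u (g j) then x else 1))"
        by (intro sum_mono ind)
      also have "\<dots> = C * (\<Sum>w\<in>V. if A u w then x else 1) ^ (s - 1)"
        using prod_sum_PiE[of J "\<lambda>_. V" "\<lambda>_ w. if A u w then x else 1"] J fin
        by (simp add: sum_distrib_left)
      \<comment> \<open>In this form the factor decreases in the degree of \<open>u\<close>, so the
        minimum degree bounds it from above.\<close>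
      also have "(\<Sum>w\<in>V. if A u w then x else 1) = (\<Sum>w\<in>V. 1 - (1 - x) * (if A u w then 1 else 0))"
        by (intro sum.cong) auto
      also have "\<dots> = n - (1 - x) * real (card {w \<in> V. A u w})"
        using fin by (simp add: n_def sum_subtractf card_filter_eq_sum if_distrib[of real] flip: sum_distrib_left cong: if_cong)
      also have "C * (n - (1 - x) * real (card {w \<in> V. A u w})) ^ (s - 1) \<le> C * (n * (1 - \<gamma> + \<gamma> * x)) ^ (s - 1)"
      proof (intro mult_left_mono power_mono)
        have "(1 - x) * (\<gamma> * n) \<le> (1 - x) * real (card {w \<in> V. A u w})"
          using deg[OF u] x by (intro mult_left_mono) (auto simp: n_def)
        then show "n - (1 - x) * real (card {w \<in> V. A u w}) \<le> n * (1 - \<gamma> + \<gamma> * x)"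
          by (simp add: algebra_simps)
        have "(1 - x) * real (card {w \<in> V. A u w}) \<le> 1 * n"
          unfolding n_def using x fin by (intro mult_mono) (auto intro!: card_mono)
        then show "0 \<le> n - (1 - x) * real (card {w \<in> V. A u w})" by simp
      qed (use C in simp)
      finally show ?thesis .
    qed
    have "real (card {f \<in> {..<s} \<rightarrow>\<^sub>E V. low f i}) = (\<Sum>u\<in>V. real (card {g \<in> J \<rightarrow>\<^sub>E V. low (g(i := u)) i}))"
      using card_filter_PiE_insert[of i J V "\<lambda>f. low f i"] J fin by simp
    also have "\<dots> \<le> n * (C * (n * (1 - \<gamma> + \<gamma> * x)) ^ (s - 1))"
      using sum_bounded_above[of V _ "C * (n * (1 - \<gamma> + \<gamma> * x)) ^ (s - 1)"] u by (simp add: n_def)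
    also have "\<dots> = (n * n ^ (s - 1)) * (C * (1 - \<gamma> + \<gamma> * x) ^ (s - 1))"
      by (simp add: power_mult_distrib)
    also have "n * n ^ (s - 1) = n ^ s" using i by (cases s) auto
    finally show ?thesis .
  qed
  have "{f \<in> {..<s} \<rightarrow>\<^sub>E V. \<exists>i<s. low f i} = (\<Union>i<s. {f \<in> {..<s} \<rightarrow>\<^sub>E V. low f i})" by auto
  then have "card {f \<in> {..<s} \<rightarrow>\<^sub>E V. \<exists>i<s. low f i} \<le> (\<Sum>i<s. card {f \<in> {..<s} \<rightarrow>\<^sub>E V. low f i})"
    using card_UN_le[of "{..<s}" "\<lambda>i. {f \<in> {..<s} \<rightarrow>\<^sub>E V. low f i}"] by simp
  then have "real (card {f \<in> {..<s} \<rightarrow>\<^sub>E V. \<exists>i<s. low f i}) \<le> (\<Sum>i<s. real (card {f \<in> {..<s} \<rightarrow>\<^sub>E V. low f i}))"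
    by (simp flip: of_nat_sum)
  also have "\<dots> \<le> real s * (n ^ s * (C * (1 - \<gamma> + \<gamma> * x) ^ (s - 1)))"
    using sum_bounded_above[of "{..<s}" _ "n ^ s * (C * (1 - \<gamma> + \<gamma> * x) ^ (s - 1))"] each by simp
  finally show ?thesis unfolding low_def n_def C_def .
qed

subsection \<open>Counting homomorphisms\<close>

text \<open>Only preservation of the relation is recorded; the range of \<open>\<phi>\<close> is
  left to the function space. Thus \<open>f \<circ> h\<close> can be tested directly for a sample
  \<open>f\<close> and a map \<open>h\<close> into its indices.\<close>

definition rel_hom :: "('a \<Rightarrow> 'a \<Rightarrow> bool) \<Rightarrow> 'a set \<Rightarrow> ('v \<Rightarrow> 'v \<Rightarrow> bool) \<Rightarrow> ('a \<Rightarrow> 'v) \<Rightarrow> bool" where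
  "rel_hom R U A \<phi> \<longleftrightarrow> (\<forall>x\<in>U. \<forall>y\<in>U. R x y \<longrightarrow> A (\<phi> x) (\<phi> y))"

text \<open>Fix the sample outside \<open>t = h x\<close>. Any two admissible values
  \<open>w\<close>, \<open>w'\<close> at \<open>t\<close> combine to an admissible sample for the
  split map: \<open>x\<close>, now over \<open>m\<close>, takes \<open>w'\<close>, and the other
  vertices over \<open>t\<close> keep \<open>w\<close>. So the sum of squares of the numbers of
  values is at most the new count, and Cauchy-Schwarz over the at most
  \<open>card V ^ (card S - 1)\<close> outer assignments finishes.\<close>

lemma card_rel_hom_split_vertex:
  fixes S :: "'i set" and V :: "'v set"
  assumes fin: "finite S" "finite V" and h: "h ` U \<subseteq> S" and x: "x \<in> U" and m: "m \<notin> S"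
    and irr: "\<And>v. \<not> A v v"
  shows "(real (card {f \<in> S \<rightarrow>\<^sub>E V. rel_hom R U A (f \<circ> h)}))\<^sup>2 \<le>
    real (card {f \<in> insert m S \<rightarrow>\<^sub>E V. rel_hom R U A (f \<circ> h(x := m))}) * real (card V) ^ (card S - 1)"
proof -
  define t where "t = h x"
  define S0 where "S0 = S - {t}"
  define P where "P = (S0 \<rightarrow>\<^sub>E V)"
  define D where "D g w \<longleftrightarrow> rel_hom R U A (g(t := w) \<circ> h)" for g w
  define E where "E g w w' \<longleftrightarrow> rel_hom R U A (g(t := w, m := w') \<circ> h(x := m))" for g w w'
  have tS: "t \<in> S" using h x by (auto simp: t_def)
  have S0: "S = insert t S0" "t \<notin> S0" "finite S0" "card S0 = card S - 1"
    using tS fin by (auto simp: S0_def)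
  have finP: "finite P" using S0 fin by (simp add: P_def finite_PiE)
  have tm: "t \<noteq> m" using tS m by auto
  have DE: "E g w w'" if "D g w" "D g w'" for g w w'
    unfolding E_def rel_hom_def
  proof (intro ballI impI)
    fix y z assume yz: "y \<in> U" "z \<in> U" "R y z"
    have a: "A ((g(t := w)) (h y)) ((g(t := w)) (h z))" "A ((g(t := w')) (h y)) ((g(t := w')) (h z))"
      using that yz by (auto simp: D_def rel_hom_def)
    \<comment> \<open>No edge lies inside a fibre of \<open>h\<close>, as it would give a loop of
      \<open>A\<close>. Hence an edge never sees both \<open>w\<close> and
      \<open>w'\<close>.\<close>
    have ne: "h y \<noteq> h z" using a(1) irr by metis
    have "h y \<noteq> m" "h z \<noteq> m" using h m yz by auto
    then show "A ((g(t := w, m := w') \<circ> h(x := m)) y) ((g(t := w, m := w') \<circ> h(x := m)) z)"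
      using a ne tm by (cases "y = x"; cases "z = x") (auto simp: t_def)
  qed
  have "card {f \<in> S \<rightarrow>\<^sub>E V. rel_hom R U A (f \<circ> h)} = (\<Sum>w\<in>V. \<Sum>g\<in>P. if D g w then 1 else 0)"
    unfolding S0(1) using S0 fin finP by (simp add: card_filter_PiE_insert card_filter_eq_sum P_def D_def)
  also have "\<dots> = (\<Sum>g\<in>P. \<Sum>w\<in>V. if D g w then 1 else 0)" by (rule sum.swap)
  also have "\<dots> = (\<Sum>g\<in>P. card {w \<in> V. D g w})" using fin by (simp add: card_filter_eq_sum)
  finally have N: "card {f \<in> S \<rightarrow>\<^sub>E V. rel_hom R U A (f \<circ> h)} = (\<Sum>g\<in>P. card {w \<in> V. D g w})" .
  have "(\<Sum>g\<in>P. (card {w \<in> V. D g w})\<^sup>2)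
      = (\<Sum>g\<in>P. \<Sum>w\<in>V. \<Sum>w'\<in>V. (if D g w then 1 else 0) * (if D g w' then 1 else 0))"
    using fin by (simp add: card_filter_eq_sum power2_eq_square sum_product)
  also have "\<dots> \<le> (\<Sum>g\<in>P. \<Sum>w\<in>V. \<Sum>w'\<in>V. if E g w w' then 1 else 0)"
    using DE by (intro sum_mono) auto
  also have "\<dots> = (\<Sum>g\<in>P. \<Sum>w'\<in>V. \<Sum>w\<in>V. if E g w w' then 1 else 0)"
    by (intro sum.cong refl sum.swap)
  also have "\<dots> = (\<Sum>w'\<in>V. \<Sum>g\<in>P. \<Sum>w\<in>V. if E g w w' then 1 else 0)" by (rule sum.swap)
  also have "\<dots> = (\<Sum>w'\<in>V. \<Sum>w\<in>V. \<Sum>g\<in>P. if E g w w' then 1 else 0)"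
    by (intro sum.cong refl sum.swap)
  also have "\<dots> = card {f \<in> insert m S \<rightarrow>\<^sub>E V. rel_hom R U A (f \<circ> h(x := m))}"
  proof -
    have "m \<notin> insert t S0" using m S0 by simp
    then show ?thesis
      unfolding S0(1) using S0 fin finP
      by (simp add: card_filter_PiE_insert card_filter_eq_sum P_def E_def)
  qed
  finally have le: "(\<Sum>g\<in>P. (card {w \<in> V. D g w})\<^sup>2) \<le> card {f \<in> insert m S \<rightarrow>\<^sub>E V. rel_hom R U A (f \<circ> h(x := m))}" .
  have "(real (card {f \<in> S \<rightarrow>\<^sub>E V. rel_hom R U A (f \<circ> h)}))\<^sup>2 = (\<Sum>g\<in>P. real (card {w \<in> V. D g w}) * 1)\<^sup>2"
    by (simp add: N)
  also have "\<dots> \<le> (\<Sum>g\<in>P. (real (card {w \<in> V. D g w}))\<^sup>2) * (\<Sum>g\<in>P. 1\<^sup>2)"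
    by (rule Cauchy_Schwarz_ineq_sum)
  also have "(\<Sum>g\<in>P. 1\<^sup>2) = real (card V) ^ (card S - 1)"
    using S0 by (simp add: P_def card_PiE)
  also have "(\<Sum>g\<in>P. (real (card {w \<in> V. D g w}))\<^sup>2) = real (\<Sum>g\<in>P. (card {w \<in> V. D g w})\<^sup>2)" by simp
  also have "\<dots> * real (card V) ^ (card S - 1) \<le>
      real (card {f \<in> insert m S \<rightarrow>\<^sub>E V. rel_hom R U A (f \<circ> h(x := m))}) * real (card V) ^ (card S - 1)"
    using le by (intro mult_right_mono) (auto simp del: of_nat_sum)
  finally show ?thesis .
qed

text \<open>For injective \<open>h\<close> a sample splits into its values on the image of
  \<open>h\<close>, which form a homomorphism on \<open>U\<close>, and arbitrary values on the other
  \<open>card S - card U\<close> indices.\<close>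

lemma card_rel_hom_inj:
  fixes S :: "'i set" and V :: "'v set"
  assumes fin: "finite S" "finite V" "finite U" and h: "h ` U \<subseteq> S" and inj: "inj_on h U"
  shows "card {f \<in> S \<rightarrow>\<^sub>E V. rel_hom R U A (f \<circ> h)} \<le>
    card {\<phi> \<in> U \<rightarrow>\<^sub>E V. rel_hom R U A \<phi>} * card V ^ (card S - card U)"
proof -
  let ?F = "\<lambda>f. (restrict (f \<circ> h) U, restrict f (S - h ` U))"
  have "inj_on ?F {f \<in> S \<rightarrow>\<^sub>E V. rel_hom R U A (f \<circ> h)}"
  proof (rule inj_onI)
    fix f g assume f: "f \<in> {f \<in> S \<rightarrow>\<^sub>E V. rel_hom R U A (f \<circ> h)}"
      and g: "g \<in> {f \<in> S \<rightarrow>\<^sub>E V. rel_hom R U A (f \<circ> h)}" and eq: "?F f = ?F g"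
    have "f i = g i" if i: "i \<in> S" for i
    proof (cases "i \<in> h ` U")
      case True
      then obtain x where "x \<in> U" "i = h x" by auto
      moreover have "restrict (f \<circ> h) U = restrict (g \<circ> h) U" using eq by simp
      ultimately show ?thesis by (metis comp_apply restrict_apply')
    next
      case False
      then have "i \<in> S - h ` U" using i by simp
      moreover have "restrict f (S - h ` U) = restrict g (S - h ` U)" using eq by simp
      ultimately show ?thesis by (metis restrict_apply')
    qed
    then show "f = g" using f g PiE_ext[of f S "\<lambda>_. V" g] by blast
  qed
  moreover have "?F ` {f \<in> S \<rightarrow>\<^sub>E V. rel_hom R U A (f \<circ> h)}
      \<subseteq> {\<phi> \<in> U \<rightarrow>\<^sub>E V. rel_hom R U A \<phi>} \<times> ((S - h ` U) \<rightarrow>\<^sub>E V)"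
  proof clarify
    fix f assume f: "f \<in> S \<rightarrow>\<^sub>E V" "rel_hom R U A (f \<circ> h)"
    have "rel_hom R U A (restrict (f \<circ> h) U)"
      using f(2) by (simp add: rel_hom_def)
    moreover have "restrict (f \<circ> h) U \<in> U \<rightarrow>\<^sub>E V" "restrict f (S - h ` U) \<in> (S - h ` U) \<rightarrow>\<^sub>E V"
      using f(1) h by (auto simp: PiE_iff)
    ultimately show "(restrict (f \<circ> h) U \<in> {\<phi> \<in> U \<rightarrow>\<^sub>E V. rel_hom R U A \<phi>}) \<and>
      restrict f (S - h ` U) \<in> (S - h ` U) \<rightarrow>\<^sub>E V" by simp
  qed
  ultimately have "card {f \<in> S \<rightarrow>\<^sub>E V. rel_hom R U A (f \<circ> h)}
      \<le> card ({\<phi> \<in> U \<rightarrow>\<^sub>E V. rel_hom R U A \<phi>} \<times> ((S - h ` U) \<rightarrow>\<^sub>E V))"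
    using fin by (intro card_inj_on_le) (auto simp: finite_PiE)
  also have "\<dots> = card {\<phi> \<in> U \<rightarrow>\<^sub>E V. rel_hom R U A \<phi>} * card V ^ (card S - card U)"
    using fin h inj by (simp add: card_cartesian_product card_PiE card_Diff_subset card_image)
  finally show ?thesis .
qed

text \<open>Each splitting enlarges the image of \<open>h\<close> by one and squares the density
  \<open>\<delta>\<close>, which accounts for the double exponent. Once \<open>h\<close> is
  injective, the indices outside its image are discarded.\<close>

lemma card_rel_hom_ge:
  fixes S :: "nat set" and V :: "'v set" and \<delta> :: real
  assumes fin: "finite S" "finite V" "finite U" "V \<noteq> {}" and h: "h ` U \<subseteq> S"
    and irr: "\<And>v. \<not> A v v" and \<delta>: "0 \<le> \<delta>"
    and ge: "\<delta> * real (card V) ^ card S \<le> real (card {f \<in> S \<rightarrow>\<^sub>E V. rel_hom R U A (f \<circ> h)})"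
  shows "\<delta> ^ 2 ^ (card U - card (h ` U)) * real (card V) ^ card U \<le> real (card {\<phi> \<in> U \<rightarrow>\<^sub>E V. rel_hom R U A \<phi>})"
  using fin(1) h \<delta> ge
proof (induction "card U - card (h ` U)" arbitrary: h S \<delta>)
  case 0
  have n: "real (card V) > 0" using fin by (simp add: card_gt_0_iff)
  have "card (h ` U) = card U" using 0 card_image_le[OF fin(3), of h] by simp
  then have inj: "inj_on h U" using fin eq_card_imp_inj_on by blast
  then have cU: "card U \<le> card S" using 0 card_inj_on_le by blast
  have "\<delta> * real (card V) ^ card S
      \<le> real (card {\<phi> \<in> U \<rightarrow>\<^sub>E V. rel_hom R U A \<phi>} * card V ^ (card S - card U))"
    using card_rel_hom_inj[OF 0(2) fin(2,3) 0(3) inj, of R A] 0(5) by (meson of_nat_mono order.trans)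
  also have "real (card V) ^ card S = real (card V) ^ card U * real (card V) ^ (card S - card U)"
    using cU by (simp flip: power_add)
  finally have "(\<delta> * real (card V) ^ card U) * real (card V) ^ (card S - card U)
      \<le> real (card {\<phi> \<in> U \<rightarrow>\<^sub>E V. rel_hom R U A \<phi>}) * real (card V) ^ (card S - card U)"
    by (simp add: mult.assoc)
  then have "\<delta> * real (card V) ^ card U \<le> real (card {\<phi> \<in> U \<rightarrow>\<^sub>E V. rel_hom R U A \<phi>})"
    using n by (simp add: mult_le_cancel_right)
  then show ?case using 0(1) by simp
next
  case (Suc k)
  have n: "real (card V) > 0" using fin by (simp add: card_gt_0_iff)
  have "\<not> inj_on h U" using Suc(2) card_image by fastforce
  then obtain x x' where x: "x \<in> U" "x' \<in> U" "x \<noteq> x'" "h x = h x'" by (auto simp: inj_on_def)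
  obtain m where m: "m \<notin> S" using Suc(3) ex_new_if_finite infinite_UNIV_nat by blast
  define h' where "h' = h(x := m)"
  have "h' ` U = insert m (h ` U)"
  proof
    show "h' ` U \<subseteq> insert m (h ` U)" by (auto simp: h'_def)
    have "h y \<in> h' ` U" if "y \<in> U" for y
    proof (cases "y = x")
      case True
      then show ?thesis using x by (intro image_eqI[of _ _ x']) (auto simp: h'_def)
    next
      case False
      then show ?thesis using that by (intro image_eqI[of _ _ y]) (auto simp: h'_def)
    qed
    moreover have "m \<in> h' ` U" using x by (intro image_eqI[of _ _ x]) (auto simp: h'_def)
    ultimately show "insert m (h ` U) \<subseteq> h' ` U" by blast
  qed
  moreover have "m \<notin> h ` U" using m Suc(4) by blast
  ultimately have k: "k = card U - card (h' ` U)" and h': "h' ` U \<subseteq> insert m S"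
    using Suc(2,4) fin by auto
  have S1: "card S \<ge> 1" using Suc(3,4) x by (auto simp: Suc_le_eq card_gt_0_iff)
  define N where "N = real (card {f \<in> insert m S \<rightarrow>\<^sub>E V. rel_hom R U A (f \<circ> h')})"
  have "(\<delta> * real (card V) ^ card S)\<^sup>2 \<le> (real (card {f \<in> S \<rightarrow>\<^sub>E V. rel_hom R U A (f \<circ> h)}))\<^sup>2"
    using Suc(5,6) by (intro power_mono) auto
  also have "\<dots> \<le> N * real (card V) ^ (card S - 1)"
    unfolding N_def h'_def using Suc(3,4) fin x m irr by (intro card_rel_hom_split_vertex) auto
  \<comment> \<open>The exponent \<open>2 * card S\<close> is regrouped as
    \<open>(card S + 1) + (card S - 1)\<close>: the first part normalizes the density over the
    enlarged index set, the second cancels the Cauchy-Schwarz factor.\<close>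
  also have "(\<delta> * real (card V) ^ card S)\<^sup>2
      = (\<delta>\<^sup>2 * real (card V) ^ card (insert m S)) * real (card V) ^ (card S - 1)"
  proof -
    have "card S + card S = Suc (card S) + (card S - 1)" using S1 by simp
    then have "real (card V) ^ card S * real (card V) ^ card S
        = real (card V) ^ Suc (card S) * real (card V) ^ (card S - 1)"
      by (metis power_add)
    then show ?thesis using m Suc(3) by (simp add: power2_eq_square mult_ac)
  qed
  finally have "\<delta>\<^sup>2 * real (card V) ^ card (insert m S) \<le> N"
    using n by (simp add: mult_le_cancel_right)
  then have "(\<delta>\<^sup>2) ^ 2 ^ (card U - card (h' ` U)) * real (card V) ^ card U
      \<le> real (card {\<phi> \<in> U \<rightarrow>\<^sub>E V. rel_hom R U A \<phi>})"
    unfolding N_def using Suc(3) h' by (intro Suc(1)[OF k]) auto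
  moreover have "(\<delta>\<^sup>2) ^ 2 ^ (card U - card (h' ` U)) = \<delta> ^ 2 ^ (card U - card (h ` U))"
    unfolding k[symmetric] Suc(2)[symmetric] by (simp flip: power_mult)
  ultimately show ?case by simp
qed

subsection \<open>Homomorphisms and copies of graphs\<close>

lemma simple_graph_edgeE:
  assumes "simple_graph G" "e \<in> edges G"
  obtains x y where "e = {x, y}" "x \<noteq> y" "x \<in> verts G" "y \<in> verts G"
  using assms unfolding simple_graph_def by (metis card_2_iff insert_subset)

lemma simple_graph_edge:
  assumes "simple_graph G" "{x, y} \<in> edges G"
  shows "x \<in> verts G" "y \<in> verts G" "x \<noteq> y"
proof -
  have "{x, y} \<subseteq> verts G" "card {x, y} = 2" using assms by (auto simp: simple_graph_def)
  then show "x \<in> verts G" "y \<in> verts G" "x \<noteq> y" by auto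
qed

lemma graph_hom_iff_rel_hom:
  assumes "simple_graph H"
  shows "graph_hom \<phi> H G \<longleftrightarrow> \<phi> ` verts H \<subseteq> verts G \<and>
    rel_hom (\<lambda>x y. {x, y} \<in> edges H) (verts H) (\<lambda>u v. {u, v} \<in> edges G) \<phi>"
proof -
  have "(\<forall>e\<in>edges H. \<phi> ` e \<in> edges G) \<longleftrightarrow>
    rel_hom (\<lambda>x y. {x, y} \<in> edges H) (verts H) (\<lambda>u v. {u, v} \<in> edges G) \<phi>"
  proof
    assume "rel_hom (\<lambda>x y. {x, y} \<in> edges H) (verts H) (\<lambda>u v. {u, v} \<in> edges G) \<phi>"
    then show "\<forall>e\<in>edges H. \<phi> ` e \<in> edges G"
      using assms by (auto simp: rel_hom_def elim!: simple_graph_edgeE)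
  qed (force simp: rel_hom_def)
  then show ?thesis by (simp add: graph_hom_def)
qed

lemma graph_hom_compose:
  assumes "graph_hom f G K" "graph_hom g K L"
  shows "graph_hom (g \<circ> f) G L"
  using assms unfolding graph_hom_def image_comp[symmetric] by blast

lemma vdegree_eq_card_neighbours:
  assumes "simple_graph G" "v \<in> verts G"
  shows "vdegree G v = card {w \<in> verts G. {v, w} \<in> edges G}"
proof -
  have "{e \<in> edges G. v \<in> e} = (\<lambda>w. {v, w}) ` {w \<in> verts G. {v, w} \<in> edges G}"
  proof
    show "{e \<in> edges G. v \<in> e} \<subseteq> (\<lambda>w. {v, w}) ` {w \<in> verts G. {v, w} \<in> edges G}"
    proof clarify
      fix e assume e: "e \<in> edges G" "v \<in> e"
      then obtain x y where xy: "e = {x, y}" "x \<in> verts G" "y \<in> verts G"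
        using simple_graph_edgeE[OF assms(1)] by metis
      then consider "v = x" | "v = y" using e by blast
      then show "e \<in> (\<lambda>w. {v, w}) ` {w \<in> verts G. {v, w} \<in> edges G}"
        using xy e by cases (auto simp: insert_commute)
    qed
  qed auto
  moreover have "inj_on (\<lambda>w. {v, w}) {w \<in> verts G. {v, w} \<in> edges G}"
    by (auto simp: inj_on_def doubleton_eq_iff)
  ultimately show ?thesis by (simp add: vdegree_def card_image)
qed

text \<open>If \<open>H\<close> maps to \<open>F\<close>, a subgraph of \<open>F\<close> of least
  size among those receiving a map from \<open>H\<close> is a minimal image, and its inclusion is a
  copy in \<open>F\<close>. Conversely, a map from \<open>H\<close> to a minimal image composes with
  any copy of that image.\<close>

lemma family_free_minimal_hom_images_iff:
  fixes F :: "nat graph" and H :: "'a graph"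
  assumes "simple_graph F"
  shows "family_free (minimal_hom_images H) F \<longleftrightarrow> \<not> admits_hom H F"
proof
  assume free: "family_free (minimal_hom_images H) F"
  show "\<not> admits_hom H F"
  proof
    assume hom: "admits_hom H F"
    define Q where "Q K \<longleftrightarrow> simple_graph K \<and> admits_hom H K \<and> subgraph_of K F" for K :: "nat graph"
    \<comment> \<open>Vertices and edges are counted together so that every proper subgraph is
      strictly smaller.\<close>
    define size where "size K = card (verts K) + card (edges K)" for K :: "nat graph"
    have "Q F" using hom assms by (simp add: Q_def subgraph_of_def)
    then obtain K where K: "Q K" "\<And>L. Q L \<Longrightarrow> size K \<le> size L"
      using ex_has_least_nat[of Q F size] by blast
    have finK: "finite (verts K)" "finite (edges K)"
    proof -
      show "finite (verts K)" using K by (simp add: Q_def simple_graph_def)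
      then show "finite (edges K)"
        using K by (intro finite_subset[of "edges K" "Pow (verts K)"]) (auto simp: Q_def simple_graph_def)
    qed
    have "L = K" if L: "simple_graph L" "admits_hom H L" "subgraph_of L K" for L
    proof -
      have sub: "verts L \<subseteq> verts K" "edges L \<subseteq> edges K" using L by (auto simp: subgraph_of_def)
      have "Q L" using L K(1) by (auto simp: Q_def subgraph_of_def)
      then have "size K \<le> size L" by (rule K(2))
      moreover have "card (verts L) \<le> card (verts K)" "card (edges L) \<le> card (edges K)"
        using sub finK by (auto intro: card_mono)
      ultimately have "card (verts L) = card (verts K)" "card (edges L) = card (edges K)"
        by (auto simp: size_def)
      then show ?thesis using sub finK card_subset_eq prod_eqI by metis
    qed
    then have "K \<in> minimal_hom_images H" using K(1) by (auto simp: minimal_hom_images_def Q_def)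
    moreover have "restrict id (verts K) \<in> copies K F"
    proof -
      have "restrict id (verts K) ` e = e" if "e \<in> edges K" for e
      proof -
        have "e \<subseteq> verts K" using K(1) that by (simp add: Q_def simple_graph_def)
        then show ?thesis by force
      qed
      then show ?thesis
        using K(1) by (auto simp: Q_def copies_def subgraph_of_def graph_hom_def inj_on_def)
    qed
    ultimately show False using free by (auto simp: family_free_def)
  qed
next
  assume no: "\<not> admits_hom H F"
  have False if "K \<in> minimal_hom_images H" "f \<in> copies K F" for K f
    using that no graph_hom_compose unfolding minimal_hom_images_def copies_def admits_hom_def
    by blast
  then show "family_free (minimal_hom_images H) F" by (auto simp: family_free_def)
qed

text \<open>Pulling \<open>G\<close> back to the indices allows \<open>f\<close> to repeat vertices.\<close>

definition sample_graph :: "nat \<Rightarrow> (nat \<Rightarrow> 'v) \<Rightarrow> 'v graph \<Rightarrow> nat graph" where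
  "sample_graph s f G = ({..<s}, {{i, j} |i j. i < s \<and> j < s \<and> {f i, f j} \<in> edges G})"

lemma edge_sample_graph_iff:
  "{i, j} \<in> edges (sample_graph s f G) \<longleftrightarrow> i < s \<and> j < s \<and> {f i, f j} \<in> edges G"
  by (auto simp: sample_graph_def doubleton_eq_iff insert_commute)

lemma verts_sample_graph [simp]: "verts (sample_graph s f G) = {..<s}"
  by (simp add: sample_graph_def)

lemma simple_sample_graph:
  assumes "simple_graph G"
  shows "simple_graph (sample_graph s f G)"
  unfolding simple_graph_def
proof (intro conjI ballI)
  fix e assume "e \<in> edges (sample_graph s f G)"
  then obtain i j where e: "e = {i, j}" "i < s" "j < s" "{f i, f j} \<in> edges G"
    by (auto simp: sample_graph_def)
  then have "i \<noteq> j" using simple_graph_edge(3)[OF assms e(4)] by auto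
  then show "e \<subseteq> verts (sample_graph s f G)" "card e = 2" using e by auto
qed simp

text \<open>This is what makes \<open>G\<close> far from mapping to \<open>F\<close>: composing a
  copy with \<open>\<phi>\<close> cannot give a homomorphism, so each copy contains an edge that
  \<open>\<phi>\<close> maps wrongly, and edge-disjoint copies give distinct such edges.\<close>

lemma card_edge_disjoint_copies_le_bad_pairs:
  fixes H :: "'a graph" and G :: "'v graph" and F :: "'c graph"
  assumes H: "simple_graph H" and G: "simple_graph G" and no: "\<not> admits_hom H F"
    and C: "C \<subseteq> copies H G" "edge_disjoint_copies H C" and \<phi>: "\<phi> ` verts G \<subseteq> verts F"
  shows "card C \<le> card {(u, w) \<in> verts G \<times> verts G. {u, w} \<in> edges G \<and> {\<phi> u, \<phi> w} \<notin> edges F}"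
proof -
  have "\<exists>x y. {x, y} \<in> edges H \<and> {\<phi> (f x), \<phi> (f y)} \<notin> edges F" if f: "f \<in> C" for f
  proof -
    have hom: "graph_hom f H G" using f C by (auto simp: copies_def)
    then have "(\<phi> \<circ> f) ` verts H \<subseteq> verts F" using \<phi> by (auto simp: graph_hom_def)
    moreover have "\<not> graph_hom (\<phi> \<circ> f) H F" using no by (auto simp: admits_hom_def)
    ultimately show ?thesis
      unfolding graph_hom_iff_rel_hom[OF H] by (auto simp: rel_hom_def)
  qed
  then obtain x y where xy: "\<And>f. f \<in> C \<Longrightarrow> {x f, y f} \<in> edges H"
    "\<And>f. f \<in> C \<Longrightarrow> {\<phi> (f (x f)), \<phi> (f (y f))} \<notin> edges F"
    by metis
  have edge: "{f (x f), f (y f)} \<in> edges G" if "f \<in> C" for f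
  proof -
    have "graph_hom f H G" using that C by (auto simp: copies_def)
    then have "f ` {x f, y f} \<in> edges G" using xy(1)[OF that] unfolding graph_hom_def by blast
    then show ?thesis by simp
  qed
  let ?p = "\<lambda>f. (f (x f), f (y f))"
  have "inj_on ?p C"
  proof (rule inj_onI)
    fix f g assume fg: "f \<in> C" "g \<in> C" "?p f = ?p g"
    have "f ` {x f, y f} = g ` {x g, y g}" using fg by simp
    then have "((`) f ` edges H) \<inter> ((`) g ` edges H) \<noteq> {}"
      using xy(1)[OF fg(1)] xy(1)[OF fg(2)] by blast
    then show "f = g" using C(2) fg unfolding edge_disjoint_copies_def by blast
  qed
  moreover have "?p ` C \<subseteq> {(u, w) \<in> verts G \<times> verts G. {u, w} \<in> edges G \<and> {\<phi> u, \<phi> w} \<notin> edges F}"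
    using edge xy(2) simple_graph_edge(1,2)[OF G edge] by auto
  moreover have "finite {(u, w) \<in> verts G \<times> verts G. {u, w} \<in> edges G \<and> {\<phi> u, \<phi> w} \<notin> edges F}"
  proof (rule finite_subset)
    show "finite (verts G \<times> verts G)" using G by (simp add: simple_graph_def)
  qed auto
  ultimately show ?thesis by (rule card_inj_on_le)
qed

text \<open>Union bound over pairs of distinct points with equal values; the value at one of them is
  then determined by the rest.\<close>

lemma card_not_inj_PiE_le:
  assumes fin: "finite U" "finite V"
  shows "card {\<phi> \<in> U \<rightarrow>\<^sub>E V. \<not> inj_on \<phi> U} \<le> card U ^ 2 * card V ^ (card U - 1)"
proof -
  define Q where "Q = {(x, y) \<in> U \<times> U. x \<noteq> y}"
  have Q: "finite Q" "card Q \<le> card U ^ 2"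
  proof -
    have "Q \<subseteq> U \<times> U" by (auto simp: Q_def)
    then show "finite Q" "card Q \<le> card U ^ 2"
      using fin card_mono[of "U \<times> U" Q] finite_subset[of Q "U \<times> U"]
      by (auto simp: card_cartesian_product power2_eq_square)
  qed
  have each: "card {\<phi> \<in> U \<rightarrow>\<^sub>E V. \<phi> x = \<phi> y} \<le> card V ^ (card U - 1)" if xy: "(x, y) \<in> Q" for x y
  proof -
    have xy': "x \<in> U" "y \<in> U" "x \<noteq> y" using xy by (auto simp: Q_def)
    have "inj_on (\<lambda>\<phi>. restrict \<phi> (U - {x})) {\<phi> \<in> U \<rightarrow>\<^sub>E V. \<phi> x = \<phi> y}"
    proof (rule inj_onI)
      fix \<phi> \<psi> assume a: "\<phi> \<in> {\<phi> \<in> U \<rightarrow>\<^sub>E V. \<phi> x = \<phi> y}" "\<psi> \<in> {\<phi> \<in> U \<rightarrow>\<^sub>E V. \<phi> x = \<phi> y}"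
        and eq: "restrict \<phi> (U - {x}) = restrict \<psi> (U - {x})"
      have other: "\<phi> z = \<psi> z" if "z \<in> U - {x}" for z
        using eq that by (metis restrict_apply')
      have "\<phi> z = \<psi> z" if "z \<in> U" for z
        using other[of z] other[of y] that a xy' by (cases "z = x") auto
      then show "\<phi> = \<psi>" using a PiE_ext[of \<phi> U "\<lambda>_. V" \<psi>] by blast
    qed
    moreover have "(\<lambda>\<phi>. restrict \<phi> (U - {x})) ` {\<phi> \<in> U \<rightarrow>\<^sub>E V. \<phi> x = \<phi> y} \<subseteq> (U - {x}) \<rightarrow>\<^sub>E V"
      by (auto simp: PiE_iff extensional_def restrict_def split: if_splits)
    moreover have "finite ((U - {x}) \<rightarrow>\<^sub>E V)" using fin by (simp add: finite_PiE)
    ultimately have "card {\<phi> \<in> U \<rightarrow>\<^sub>E V. \<phi> x = \<phi> y} \<le> card ((U - {x}) \<rightarrow>\<^sub>E V)"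
      by (rule card_inj_on_le)
    then show ?thesis using fin xy' by (simp add: card_PiE)
  qed
  have "{\<phi> \<in> U \<rightarrow>\<^sub>E V. \<not> inj_on \<phi> U} \<subseteq> (\<Union>(x, y)\<in>Q. {\<phi> \<in> U \<rightarrow>\<^sub>E V. \<phi> x = \<phi> y})"
    by (auto simp: inj_on_def Q_def)
  then have "card {\<phi> \<in> U \<rightarrow>\<^sub>E V. \<not> inj_on \<phi> U} \<le> card (\<Union>(x, y)\<in>Q. {\<phi> \<in> U \<rightarrow>\<^sub>E V. \<phi> x = \<phi> y})"
    using Q fin by (intro card_mono) (auto simp: finite_PiE)
  also have "\<dots> \<le> (\<Sum>(x, y)\<in>Q. card {\<phi> \<in> U \<rightarrow>\<^sub>E V. \<phi> x = \<phi> y})"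
    using card_UN_le[OF Q(1), of "\<lambda>(x, y). {\<phi> \<in> U \<rightarrow>\<^sub>E V. \<phi> x = \<phi> y}"]
    by (simp add: case_prod_unfold)
  also have "\<dots> \<le> (\<Sum>p\<in>Q. card V ^ (card U - 1))"
    using each by (intro sum_mono) auto
  also have "\<dots> \<le> card U ^ 2 * card V ^ (card U - 1)" using Q by simp
  finally show ?thesis .
qed

subsection \<open>Sample size\<close>

text \<open>The difference \<open>g\<close> of the two sides of
  \<open>1 - \<gamma> + \<gamma> * x < x powr \<gamma>0\<close> vanishes at 1 and has derivative
  \<open>\<gamma>0 - \<gamma> < 0\<close> there, so it is positive slightly to the left of
  1.\<close>

lemma exists_chernoff_base:
  fixes \<gamma>0 \<gamma> :: real
  assumes "\<gamma>0 < \<gamma>"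
  obtains x where "0 < x" "x < 1" "x powr (- \<gamma>0) * (1 - \<gamma> + \<gamma> * x) < 1"
proof -
  define g where "g x = x powr \<gamma>0 - (1 - \<gamma> + \<gamma> * x)" for x :: real
  have "(g has_real_derivative \<gamma>0 - \<gamma>) (at 1)"
    unfolding g_def by (auto intro!: derivative_eq_intros)
  then obtain d where d: "d > 0" "\<And>h. h > 0 \<Longrightarrow> h < d \<Longrightarrow> g 1 < g (1 - h)"
    using DERIV_neg_dec_left[of g "\<gamma>0 - \<gamma>" 1] assms by auto
  \<comment> \<open>The first bound stays within the range given by the derivative, the second keeps
    \<open>x\<close> positive.\<close>
  define h where "h = min (d / 2) (1 / 2)"
  have h: "0 < h" "h < d" "h \<le> 1 / 2" using d(1) by (auto simp: h_def)
  define x where "x = 1 - h"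
  have x: "0 < x" "x < 1" using h by (auto simp: x_def)
  have "1 - \<gamma> + \<gamma> * x < x powr \<gamma>0" using d(2)[OF h(1,2)] by (simp add: g_def x_def)
  then have "x powr (- \<gamma>0) * (1 - \<gamma> + \<gamma> * x) < x powr (- \<gamma>0) * x powr \<gamma>0"
    using x by (intro mult_strict_left_mono) auto
  also have "\<dots> = 1" using x by (simp flip: powr_add)
  finally show ?thesis using that x by blast
qed

text \<open>Up to the constant factor \<open>1 / q\<close>, caused by the exponent
  \<open>s - 1\<close>, the expression is \<open>s * \<rho> ^ s\<close> with
  \<open>\<rho> < 1\<close>, which tends to 0. The resulting \<open>s0\<close> does not depend on
  \<epsilon> or on the host graph.\<close>

lemma eventually_degree_failure_small:
  fixes \<gamma>0 \<gamma> x :: real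
  assumes x: "0 < x" "x < 1" "x powr (- \<gamma>0) * (1 - \<gamma> + \<gamma> * x) < 1" and \<gamma>: "\<gamma> \<le> 1"
  obtains s0 where
    "\<And>s. s \<ge> s0 \<Longrightarrow> real s * (x powr (- \<gamma>0 * real s) * (1 - \<gamma> + \<gamma> * x) ^ (s - 1)) \<le> 1 / 4"
proof -
  define q where "q = 1 - \<gamma> + \<gamma> * x"
  define \<rho> where "\<rho> = x powr (- \<gamma>0) * q"
  have q: "q > 0"
  proof (cases "\<gamma> \<le> 0")
    case True
    have "\<gamma> * x \<ge> \<gamma> * 1" using True x by (intro mult_left_mono_neg) auto
    then show ?thesis by (simp add: q_def)
  next
    case False
    then show ?thesis using x \<gamma> by (simp add: q_def add_nonneg_pos)
  qed
  have \<rho>: "0 < \<rho>" "\<rho> < 1" using x q by (auto simp: \<rho>_def q_def)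
  have "(\<lambda>s. real s * \<rho> ^ s) \<longlonglongrightarrow> 0" using \<rho> by (intro powser_times_n_limit_0) auto
  then have "\<forall>\<^sub>F s in sequentially. real s * \<rho> ^ s < q / 4"
    using q by (intro order_tendstoD) auto
  then obtain s0 where s0: "\<And>s. s \<ge> s0 \<Longrightarrow> real s * \<rho> ^ s < q / 4"
    unfolding eventually_sequentially by blast
  \<comment> \<open>Requiring \<open>s\<close> to be at least 1 makes \<open>q ^ s\<close> equal to
    \<open>q * q ^ (s - 1)\<close> despite truncated subtraction.\<close>
  have "real s * (x powr (- \<gamma>0 * real s) * q ^ (s - 1)) \<le> 1 / 4" if s: "s \<ge> max s0 1" for s
  proof -
    have "\<rho> ^ s = x powr (- \<gamma>0 * real s) * q ^ s"
      unfolding \<rho>_def power_mult_distrib using x by (simp add: powr_powr flip: powr_realpow)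
    also have "q ^ s = q * q ^ (s - 1)" using s by (cases s) auto
    finally have "q * (real s * (x powr (- \<gamma>0 * real s) * q ^ (s - 1))) < q * (1 / 4)"
      using s0[of s] s by (simp add: mult_ac)
    then show ?thesis using q by simp
  qed
  then show ?thesis using that unfolding q_def by blast
qed

text \<open>The first factor is the exponential of a constant over \<epsilon>, while the second is
  at most \<open>exp (- (\<epsilon> / 6 * s))\<close>. A sample of size
  \<open>C / \<epsilon>\<^sup>2\<close> makes the latter exponent of order
  \<open>C / \<epsilon>\<close> too, and \<open>C\<close> is large enough to win by
  \<open>ln 4\<close>.\<close>

lemma colouring_failure_small:
  fixes k :: nat and \<epsilon> C :: real
  assumes \<epsilon>: "0 < \<epsilon>" "\<epsilon> \<le> 1" and C: "18 * real k * ln (2 * real k) + 6 * ln 4 \<le> C"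
    and s: "C / \<epsilon>\<^sup>2 \<le> real s" and k: "k > 0"
  shows "(2 * real k) powr (3 * real k / \<epsilon>) * (1 - \<epsilon> / 6) ^ s \<le> 1 / 4"
proof -
  have "(1 - \<epsilon> / 6) ^ s \<le> exp (- (\<epsilon> / 6)) ^ s"
    using \<epsilon> exp_ge_add_one_self[of "- (\<epsilon> / 6)"] by (intro power_mono) auto
  also have "\<dots> = exp (- (\<epsilon> / 6 * real s))" by (simp flip: exp_of_nat_mult)
  finally have 1: "(1 - \<epsilon> / 6) ^ s \<le> exp (- (\<epsilon> / 6 * real s))" .
  have "\<epsilon> / 6 * (C / \<epsilon>\<^sup>2) \<le> \<epsilon> / 6 * real s" using s \<epsilon> by (intro mult_left_mono) auto
  then have 2: "C / 6 / \<epsilon> \<le> \<epsilon> / 6 * real s" using \<epsilon> by (simp add: power2_eq_square)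
  have "(3 * real k * ln (2 * real k) + ln 4) / \<epsilon> \<le> C / 6 / \<epsilon>"
    using C \<epsilon> by (intro divide_right_mono) auto
  moreover have "ln 4 \<le> ln 4 / \<epsilon>" using \<epsilon> by (simp add: le_divide_eq mult_left_le)
  ultimately have 3: "3 * real k / \<epsilon> * ln (2 * real k) - \<epsilon> / 6 * real s \<le> - ln 4"
    using 2 by (simp add: add_divide_distrib)
  have "(2 * real k) powr (3 * real k / \<epsilon>) * (1 - \<epsilon> / 6) ^ s
      \<le> (2 * real k) powr (3 * real k / \<epsilon>) * exp (- (\<epsilon> / 6 * real s))"
    using 1 by (intro mult_left_mono) auto
  also have "\<dots> = exp (3 * real k / \<epsilon> * ln (2 * real k) - \<epsilon> / 6 * real s)"
    using k by (simp add: powr_def flip: exp_add)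
  also have "\<dots> \<le> exp (- ln 4)" using 3 by simp
  also have "\<dots> = 1 / 4" by (simp add: exp_minus)
  finally show ?thesis .
qed

subsection \<open>Polynomial removal\<close>

text \<open>At most a quarter of the samples induce a graph mapping to \<open>F\<close>, and at most
  a quarter one of low degree. The threshold property makes \<open>H\<close> map to each of the
  others, and averaging over the \<open>s ^ card (verts H)\<close> possible maps selects
  \<open>h\<close>.\<close>

lemma exists_common_hom_pattern:
  fixes H :: "'a graph" and F G :: "nat graph"
  assumes H: "simple_graph H" and F: "simple_graph F" "\<not> admits_hom H F"
    and thr: "\<And>K :: nat graph. simple_graph K \<Longrightarrow> \<not> admits_hom H K \<Longrightarrow>
      min_degree_at_least K (\<gamma>0 * real (card (verts K))) \<Longrightarrow> admits_hom K F"
    and G: "simple_graph G" "verts G \<noteq> {}" "min_degree_at_least G (\<gamma> * real (card (verts G)))"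
    and cont: "contains_edge_disjoint_copies G H (\<epsilon> * real (card (verts G)) ^ 2)"
    and \<epsilon>: "0 < \<epsilon>" "\<epsilon> \<le> 1" and \<gamma>: "\<gamma> \<le> 1" and x: "0 < x" "x < 1" and s: "s > 0"
    and col: "card (verts F) > 0 \<Longrightarrow>
      (2 * real (card (verts F))) powr (3 * real (card (verts F)) / \<epsilon>) * (1 - \<epsilon> / 6) ^ s \<le> 1 / 4"
    and low: "real s * (x powr (- \<gamma>0 * real s) * (1 - \<gamma> + \<gamma> * x) ^ (s - 1)) \<le> 1 / 4"
  obtains h where "h \<in> verts H \<rightarrow>\<^sub>E {..<s}"
    "real (card (verts G)) ^ s / (2 * real s ^ card (verts H)) \<le>
      real (card {f \<in> {..<s} \<rightarrow>\<^sub>E verts G.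
        rel_hom (\<lambda>x y. {x, y} \<in> edges H) (verts H) (\<lambda>u v. {u, v} \<in> edges G) (f \<circ> h)})"
proof -
  define V where "V = verts G"
  define A where "A u v \<longleftrightarrow> {u, v} \<in> edges G" for u v
  define B where "B a b \<longleftrightarrow> {a, b} \<in> edges F" for a b
  define R where "R x y \<longleftrightarrow> {x, y} \<in> edges H" for x y
  define n where "n = real (card V)"
  define P where "P = ({..<s} \<rightarrow>\<^sub>E V)"
  define T where "T = (verts H \<rightarrow>\<^sub>E {..<s})"
  define good where "good f h \<longleftrightarrow> rel_hom R (verts H) A (f \<circ> h)" for f :: "nat \<Rightarrow> nat" and h
  define Pcol where "Pcol = {f \<in> P. list_colourable A B (\<lambda>_. verts F) {..<s} f}"
  define Plow where "Plow = {f \<in> P. \<exists>i<s. real (card {j. j < s \<and> A (f i) (f j)}) < \<gamma>0 * real s}"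
  define Phom where "Phom = {f \<in> P. \<exists>h\<in>T. good f h}"
  have fin: "finite V" "finite (verts F)" "finite (verts H)"
    using G F H by (auto simp: V_def simple_graph_def)
  have V: "V \<noteq> {}" using G by (simp add: V_def)
  have n: "n > 0" using fin V by (simp add: n_def card_gt_0_iff)
  have finP: "finite P" using fin by (simp add: P_def finite_PiE)
  have cP: "real (card P) = n ^ s" using fin by (simp add: P_def n_def card_PiE)
  have finT: "finite T" using fin by (simp add: T_def finite_PiE)
  have cT: "real (card T) = real s ^ card (verts H)" using fin by (simp add: T_def card_PiE)

  have "real (card Pcol) \<le> n ^ s / 4"
  proof (cases "verts F = {}")
    case True
    \<comment> \<open>Since \<open>s > 0\<close>, some index needs a colour, and an empty target
      offers none.\<close>
    then have "Pcol = {}" using s by (auto simp: Pcol_def list_colourable_def)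
    then show ?thesis using n by simp
  next
    case False
    then have k: "card (verts F) > 0" using fin by (simp add: card_gt_0_iff)
    obtain C where C: "C \<subseteq> copies H G" "edge_disjoint_copies H C" "\<epsilon> * n ^ 2 \<le> real (card C)"
      using cont by (auto simp: contains_edge_disjoint_copies_def n_def V_def)
    have far: "\<epsilon> * real (card V) ^ 2 \<le> real (card {(u, w) \<in> V \<times> V. A u w \<and> \<not> B (\<phi> u) (\<phi> w)})"
      if "\<phi> ` V \<subseteq> verts F" for \<phi>
    proof -
      have "card C \<le> card {(u, w) \<in> V \<times> V. A u w \<and> \<not> B (\<phi> u) (\<phi> w)}"
        using card_edge_disjoint_copies_le_bad_pairs[OF H G(1) F(2) C(1,2)] that
        by (simp add: V_def A_def B_def)
      then show ?thesis using C(3) by (simp add: n_def)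
    qed
    have "real (card Pcol) \<le> n ^ card {..<s} * (2 * real (card (verts F)))
        powr (real (\<Sum>v\<in>V. card (verts F)) / (\<epsilon> / 3 * n)) * (1 - \<epsilon> / 6) ^ card {..<s}"
      unfolding Pcol_def P_def n_def
      using fin V False \<epsilon> far by (intro card_list_colourable_le) auto
    \<comment> \<open>Initially every list is full, so the total list length is
      \<open>n * card (verts F)\<close> and \<open>n\<close> cancels from the exponent.\<close>
    also have "real (\<Sum>v\<in>V. card (verts F)) / (\<epsilon> / 3 * n) = 3 * real (card (verts F)) / \<epsilon>"
      using n by (simp add: n_def)
    finally have "real (card Pcol) \<le> n ^ s *
      ((2 * real (card (verts F))) powr (3 * real (card (verts F)) / \<epsilon>) * (1 - \<epsilon> / 6) ^ s)"
      by (simp add: mult.assoc)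
    also have "\<dots> \<le> n ^ s * (1 / 4)" using col[OF k] n by (intro mult_left_mono) auto
    finally show ?thesis by simp
  qed
  moreover have "real (card Plow) \<le> n ^ s / 4"
  proof -
    have deg: "\<gamma> * real (card V) \<le> real (card {w \<in> V. A u w})" if "u \<in> V" for u
    proof -
      have "\<gamma> * real (card (verts G)) \<le> real (vdegree G u)"
        using G(3) that unfolding min_degree_at_least_def V_def by blast
      then show ?thesis
        using vdegree_eq_card_neighbours[OF G(1), of u] that by (simp add: V_def A_def)
    qed
    have "real (card Plow) \<le> real s * (n ^ s * (x powr (- \<gamma>0 * real s) * (1 - \<gamma> + \<gamma> * x) ^ (s - 1)))"
      unfolding Plow_def P_def n_def by (rule card_low_degree_le[OF fin(1) x \<gamma> deg])
    also have "\<dots> = n ^ s * (real s * (x powr (- \<gamma>0 * real s) * (1 - \<gamma> + \<gamma> * x) ^ (s - 1)))"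
      by simp
    also have "\<dots> \<le> n ^ s * (1 / 4)" using low n by (intro mult_left_mono) auto
    finally show ?thesis by simp
  qed
  moreover have "P \<subseteq> Pcol \<union> Plow \<union> Phom"
  proof
    fix f assume f: "f \<in> P"
    let ?S = "sample_graph s f G"
    have S: "simple_graph ?S" by (rule simple_sample_graph[OF G(1)])
    \<comment> \<open>The threshold property of \<open>F\<close>, applied to the sampled graph on
      \<open>s\<close> vertices and read as a disjunction.\<close>
    consider "admits_hom H ?S" | "\<not> min_degree_at_least ?S (\<gamma>0 * real s)" | "admits_hom ?S F"
      using thr[OF S] by auto
    then show "f \<in> Pcol \<union> Plow \<union> Phom"
    proof cases
      case 1
      then obtain h where h: "graph_hom h H ?S" by (auto simp: admits_hom_def)
      define h' where "h' = restrict h (verts H)"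
      have "h' \<in> T" using h by (auto simp: T_def h'_def graph_hom_def)
      moreover have "good f h'"
        using h unfolding graph_hom_iff_rel_hom[OF H] good_def h'_def rel_hom_def R_def A_def
        by (auto simp: edge_sample_graph_iff)
      ultimately show ?thesis using f by (auto simp: Phom_def)
    next
      case 2
      then obtain i where i: "i < s" "real (vdegree ?S i) < \<gamma>0 * real s"
        by (auto simp: min_degree_at_least_def)
      have "vdegree ?S i = card {j. j < s \<and> A (f i) (f j)}"
        using vdegree_eq_card_neighbours[OF S, of i] i
        by (simp add: edge_sample_graph_iff A_def cong: conj_cong)
      then show ?thesis using f i by (auto simp: Plow_def)
    next
      case 3
      then obtain c where c: "graph_hom c ?S F" by (auto simp: admits_hom_def)
      have "list_colourable A B (\<lambda>_. verts F) {..<s} f"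
        unfolding list_colourable_def
      proof (intro exI[of _ c] conjI ballI impI)
        show "c j \<in> verts F" if "j \<in> {..<s}" for j using c that by (auto simp: graph_hom_def)
        show "B (c i) (c j)" if "i \<in> {..<s}" "j \<in> {..<s}" "A (f i) (f j)" for i j
          using c that unfolding graph_hom_iff_rel_hom[OF S] rel_hom_def A_def B_def
          by (auto simp: edge_sample_graph_iff)
      qed
      then show ?thesis using f by (simp add: Pcol_def)
    qed
  qed
  then have "card P \<le> card (Pcol \<union> Plow \<union> Phom)"
    using finP by (intro card_mono) (auto simp: Pcol_def Plow_def Phom_def)
  then have "card P \<le> card Pcol + card Plow + card Phom"
    using card_Un_le[of "Pcol \<union> Plow" Phom] card_Un_le[of Pcol Plow] by linarith
  ultimately have half: "n ^ s / 2 \<le> real (card Phom)" using cP by linarith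

  have "\<exists>h\<in>T. n ^ s / (2 * real s ^ card (verts H)) \<le> real (card {f \<in> P. good f h})"
  proof (rule ccontr)
    assume neg: "\<not> ?thesis"
    have T0: "T \<noteq> {}" using s by (auto simp: T_def PiE_eq_empty_iff)
    have "Phom = (\<Union>h\<in>T. {f \<in> P. good f h})" by (auto simp: Phom_def)
    then have "card Phom \<le> (\<Sum>h\<in>T. card {f \<in> P. good f h})"
      using card_UN_le[OF finT] by simp
    then have "real (card Phom) \<le> (\<Sum>h\<in>T. real (card {f \<in> P. good f h}))" by (simp flip: of_nat_sum)
    also have "\<dots> < (\<Sum>h\<in>T. n ^ s / (2 * real s ^ card (verts H)))"
      using neg T0 finT by (intro sum_strict_mono) auto
    also have "\<dots> = n ^ s / 2" using s by (simp add: cT)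
    finally show False using half by simp
  qed
  then show ?thesis
    using that unfolding T_def n_def V_def P_def good_def R_def A_def by blast
qed

text \<open>The sample size is of order \<open>1 / \<epsilon>\<^sup>2\<close>, so the common pattern
  \<open>h\<close> has density at least
  \<open>(\<epsilon>\<^sup>2 / C) ^ card (verts H) / 2\<close>, and splitting its fibres raises this
  to the power \<open>2 ^ card (verts H)\<close> at worst. \<open>C\<close> is chosen before
  \<epsilon> and \<open>G\<close>.\<close>

lemma many_homs:
  fixes H :: "'a graph" and F :: "nat graph"
  assumes H: "simple_graph H" and F: "simple_graph F" "\<not> admits_hom H F"
    and thr: "\<And>K :: nat graph. simple_graph K \<Longrightarrow> \<not> admits_hom H K \<Longrightarrow>
      min_degree_at_least K (\<gamma>0 * real (card (verts K))) \<Longrightarrow> admits_hom K F"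
    and \<gamma>: "\<gamma>0 < \<gamma>" "\<gamma> \<le> 1"
  obtains C :: real where "C \<ge> 1" and
    "\<And>\<epsilon> (G :: nat graph). 0 < \<epsilon> \<Longrightarrow> \<epsilon> \<le> 1 \<Longrightarrow> simple_graph G \<Longrightarrow> verts G \<noteq> {} \<Longrightarrow>
      min_degree_at_least G (\<gamma> * real (card (verts G))) \<Longrightarrow>
      contains_edge_disjoint_copies G H (\<epsilon> * real (card (verts G)) ^ 2) \<Longrightarrow>
      ((\<epsilon>\<^sup>2 / C) ^ card (verts H) / 2) ^ 2 ^ card (verts H) * real (card (verts G)) ^ card (verts H) \<le>
      real (card {\<phi> \<in> verts H \<rightarrow>\<^sub>E verts G. graph_hom \<phi> H G})"
proof -
  obtain x where x: "0 < x" "x < 1" "x powr (- \<gamma>0) * (1 - \<gamma> + \<gamma> * x) < 1"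
    using exists_chernoff_base[OF \<gamma>(1)] by blast
  obtain s0 where s0: "\<And>s. s \<ge> s0 \<Longrightarrow>
      real s * (x powr (- \<gamma>0 * real s) * (1 - \<gamma> + \<gamma> * x) ^ (s - 1)) \<le> 1 / 4"
    using eventually_degree_failure_small[OF x \<gamma>(2)] by blast
  define k where "k = card (verts F)"
  define v where "v = card (verts H)"
  \<comment> \<open>The three entries serve the colouring bound, the degree bound and
    \<open>s > 0\<close>.\<close>
  define C0 where "C0 = max (18 * real k * ln (2 * real k) + 6 * ln 4) (max (real s0) 1)"
  \<comment> \<open>The extra 1 pays for rounding \<open>C0 / \<epsilon>\<^sup>2\<close> up to an
    integer, as \<open>1 \<le> 1 / \<epsilon>\<^sup>2\<close>.\<close>
  define C where "C = C0 + 1"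
  have C0: "18 * real k * ln (2 * real k) + 6 * ln 4 \<le> C0" "real s0 \<le> C0" "1 \<le> C0"
    by (auto simp: C0_def)
  have "((\<epsilon>\<^sup>2 / C) ^ v / 2) ^ 2 ^ v * real (card (verts G)) ^ v
      \<le> real (card {\<phi> \<in> verts H \<rightarrow>\<^sub>E verts G. graph_hom \<phi> H G})"
    if \<epsilon>: "0 < \<epsilon>" "\<epsilon> \<le> 1" and G: "simple_graph G" "verts G \<noteq> {}"
      "min_degree_at_least G (\<gamma> * real (card (verts G)))"
      "contains_edge_disjoint_copies G H (\<epsilon> * real (card (verts G)) ^ 2)"
    for \<epsilon> and G :: "nat graph"
  proof -
    define s where "s = nat \<lceil>C0 / \<epsilon>\<^sup>2\<rceil>"
    define n where "n = real (card (verts G))"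
    define \<delta> where "\<delta> = (\<epsilon>\<^sup>2 / C) ^ v / 2"
    let ?R = "\<lambda>x y. {x, y} \<in> edges H" and ?A = "\<lambda>u v. {u, v} \<in> edges G"
    have \<epsilon>2: "0 < \<epsilon>\<^sup>2" "\<epsilon>\<^sup>2 \<le> 1" using \<epsilon> by (auto simp: power_le_one)
    have "C0 * \<epsilon>\<^sup>2 \<le> C0 * 1" using C0 \<epsilon>2 by (intro mult_left_mono) auto
    then have "C0 \<le> C0 / \<epsilon>\<^sup>2" using \<epsilon>2 by (simp add: le_divide_eq)
    moreover have sC: "C0 / \<epsilon>\<^sup>2 \<le> real s" unfolding s_def by linarith
    ultimately have s: "real s0 \<le> real s" "1 \<le> real s" "s > 0" using C0 by linarith+
    have "real s \<le> C0 / \<epsilon>\<^sup>2 + 1" using C0 \<epsilon>2 unfolding s_def by simp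
    also have "1 \<le> 1 / \<epsilon>\<^sup>2" using \<epsilon>2 by simp
    finally have sle: "real s \<le> C / \<epsilon>\<^sup>2" by (simp add: C_def add_divide_distrib)
    have col: "(2 * real k) powr (3 * real k / \<epsilon>) * (1 - \<epsilon> / 6) ^ s \<le> 1 / 4" if "k > 0"
      using colouring_failure_small[OF \<epsilon> C0(1) sC that] .
    have low: "real s * (x powr (- \<gamma>0 * real s) * (1 - \<gamma> + \<gamma> * x) ^ (s - 1)) \<le> 1 / 4"
      using s0 s by simp
    obtain h where h: "h \<in> verts H \<rightarrow>\<^sub>E {..<s}"
      "n ^ s / (2 * real s ^ v) \<le> real (card {f \<in> {..<s} \<rightarrow>\<^sub>E verts G. rel_hom ?R (verts H) ?A (f \<circ> h)})"
      using exists_common_hom_pattern[OF H F thr G \<epsilon> \<gamma>(2) x(1,2) s(3) col[unfolded k_def] low]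
      unfolding v_def n_def by blast
    have n: "n > 0" using G by (simp add: n_def simple_graph_def card_gt_0_iff)
    have \<delta>01: "0 \<le> \<delta>" "\<delta> \<le> 1"
    proof -
      have "0 \<le> \<epsilon>\<^sup>2 / C" "\<epsilon>\<^sup>2 / C \<le> 1" using \<epsilon>2 C0 by (auto simp: C_def divide_le_eq)
      then have "0 \<le> (\<epsilon>\<^sup>2 / C) ^ v" "(\<epsilon>\<^sup>2 / C) ^ v \<le> 1" by (auto intro: power_le_one)
      then show "0 \<le> \<delta>" "\<delta> \<le> 1" by (auto simp: \<delta>_def)
    qed
    have "\<delta> \<le> 1 / (2 * real s ^ v)"
    proof -
      have "\<epsilon>\<^sup>2 / C \<le> 1 / real s" using sle \<epsilon>2 s C0 by (simp add: C_def field_simps)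
      then have "(\<epsilon>\<^sup>2 / C) ^ v \<le> (1 / real s) ^ v"
        using \<epsilon>2 C0 by (intro power_mono) (auto simp: C_def)
      then show ?thesis by (simp add: \<delta>_def power_divide)
    qed
    then have "\<delta> * n ^ s \<le> 1 / (2 * real s ^ v) * n ^ s" using n by (intro mult_right_mono) auto
    then have "\<delta> * real (card (verts G)) ^ card {..<s}
        \<le> real (card {f \<in> {..<s} \<rightarrow>\<^sub>E verts G. rel_hom ?R (verts H) ?A (f \<circ> h)})"
      using h(2) by (simp add: n_def)
    then have "\<delta> ^ 2 ^ (card (verts H) - card (h ` verts H)) * real (card (verts G)) ^ card (verts H)
        \<le> real (card {\<phi> \<in> verts H \<rightarrow>\<^sub>E verts G. rel_hom ?R (verts H) ?A \<phi>})"
      using h(1) G H \<delta>01 simple_graph_edge(3)[OF G(1)]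
      by (intro card_rel_hom_ge[where S = "{..<s}" and h = h]) (auto simp: simple_graph_def)
    \<comment> \<open>Since \<open>\<delta> \<le> 1\<close>, the number of splittings may be
      replaced by its upper bound \<open>v\<close>, which does not depend on
      \<open>h\<close>.\<close>
    moreover have "\<delta> ^ 2 ^ v * n ^ v \<le> \<delta> ^ 2 ^ (v - card (h ` verts H)) * n ^ v"
      using \<delta>01 n by (intro mult_right_mono power_decreasing power_increasing) auto
    moreover have "{\<phi> \<in> verts H \<rightarrow>\<^sub>E verts G. rel_hom ?R (verts H) ?A \<phi>}
        = {\<phi> \<in> verts H \<rightarrow>\<^sub>E verts G. graph_hom \<phi> H G}"
      by (auto simp: graph_hom_iff_rel_hom[OF H])
    ultimately show ?thesis by (simp add: n_def v_def \<delta>_def)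
  qed
  moreover have "C \<ge> 1" using C0 by (simp add: C_def)
  ultimately show ?thesis using that unfolding v_def by blast
qed

lemma finite_copies: "simple_graph H \<Longrightarrow> simple_graph G \<Longrightarrow> finite (copies H G)"
  unfolding copies_def simple_graph_def
  by (rule finite_subset[of _ "verts H \<rightarrow>\<^sub>E verts G"]) (auto intro: finite_PiE)

text \<open>With \<open>Z\<close> the denominator: if \<open>D * n\<close> is at least
  \<open>Z\<close>, non-injective maps are at most half of the guaranteed homomorphisms. Otherwise
  \<open>(D / Z * n) ^ v\<close> is at most 1 and one copy suffices. The exponent
  \<open>v + 1\<close> covers both cases, even for \<open>v = 0\<close>.\<close>

lemma card_copies_ge:
  fixes H :: "'a graph" and G :: "'v graph" and D :: real
  assumes H: "simple_graph H" and G: "simple_graph G" "verts G \<noteq> {}" and D: "0 < D" "D \<le> 1"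
    and homs: "D * real (card (verts G)) ^ card (verts H)
      \<le> real (card {\<phi> \<in> verts H \<rightarrow>\<^sub>E verts G. graph_hom \<phi> H G})"
    and ne: "copies H G \<noteq> {}"
  shows "(D / (2 * real (card (verts H)) ^ 2 + 2)) ^ (card (verts H) + 1) * real (card (verts G)) ^ card (verts H)
    \<le> real (card (copies H G))"
proof -
  define v where "v = card (verts H)"
  define n where "n = real (card (verts G))"
  define Z where "Z = 2 * real v ^ 2 + 2"
  define Q where "Q = {\<phi> \<in> verts H \<rightarrow>\<^sub>E verts G. graph_hom \<phi> H G}"
  define I where "I = {\<phi> \<in> verts H \<rightarrow>\<^sub>E verts G. \<not> inj_on \<phi> (verts H)}"
  have fin: "finite (verts H)" "finite (verts G)" using H G by (auto simp: simple_graph_def)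
  have n: "n > 0" using fin G by (simp add: n_def card_gt_0_iff)
  have finPiE: "finite (verts H \<rightarrow>\<^sub>E verts G)" using fin by (simp add: finite_PiE)
  have Z: "Z \<ge> 2" by (simp add: Z_def)
  have DZ: "0 < D / Z" "D / Z \<le> 1" "D / Z \<le> D / 2"
    using D Z by (auto simp: divide_le_eq frac_le)
  have "(D / Z) ^ (v + 1) * n ^ v \<le> real (card (copies H G))"
  proof (cases "Z \<le> D * n")
    case True
    have "Q \<subseteq> copies H G \<union> I" by (auto simp: Q_def copies_def I_def)
    then have "card Q \<le> card (copies H G \<union> I)"
      using finPiE finite_copies[OF H G(1)] by (intro card_mono) (auto simp: I_def)
    also have "\<dots> \<le> card (copies H G) + card I" by (rule card_Un_le)
    finally have "real (card Q) \<le> real (card (copies H G)) + real (card I)" by linarith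
    moreover have "real (card I) \<le> D / 2 * n ^ v"
    proof -
      have "real (card I) \<le> real (v ^ 2 * card (verts G) ^ (v - 1))"
        unfolding I_def v_def by (intro of_nat_mono card_not_inj_PiE_le fin)
      also have "\<dots> = real v ^ 2 * n ^ (v - 1)" by (simp add: n_def)
      also have "\<dots> \<le> D / 2 * n ^ v"
      proof (cases v)
        case 0
        then show ?thesis using D by simp
      next
        case (Suc w)
        have "real v ^ 2 \<le> D / 2 * n" using True by (simp add: Z_def)
        then have "real v ^ 2 * n ^ w \<le> D / 2 * n * n ^ w" using n by (intro mult_right_mono) auto
        then show ?thesis using Suc by simp
      qed
      finally show ?thesis .
    qed
    moreover have "D * n ^ v \<le> real (card Q)" using homs by (simp add: n_def v_def Q_def)
    ultimately have "D / 2 * n ^ v \<le> real (card (copies H G))" by simp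
    moreover have "(D / Z) ^ (v + 1) * n ^ v \<le> D / 2 * n ^ v"
    proof (intro mult_right_mono)
      have "(D / Z) ^ (v + 1) \<le> (D / Z) ^ 1" using DZ by (intro power_decreasing) auto
      then show "(D / Z) ^ (v + 1) \<le> D / 2" using DZ(3) unfolding power_one_right by (rule order.trans)
    qed (use n in simp)
    ultimately show ?thesis by linarith
  next
    case False
    have "(D / Z) ^ (v + 1) * n ^ v \<le> (D / Z) ^ v * n ^ v"
      using DZ n by (intro mult_right_mono power_decreasing) auto
    also have "\<dots> = (D / Z * n) ^ v" by (rule power_mult_distrib[symmetric])
    also have "\<dots> \<le> 1"
    proof (rule power_le_one)
      show "0 \<le> D / Z * n" using D Z n by simp
      show "D / Z * n \<le> 1" using False Z by (simp add: divide_le_eq)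
    qed
    also have "1 \<le> real (card (copies H G))"
      using ne finite_copies[OF H G(1)] by (simp add: Suc_le_eq card_gt_0_iff)
    finally show ?thesis .
  qed
  then show ?thesis by (simp add: v_def n_def Z_def)
qed

lemma power_ge_mu_powr:
  fixes c :: real and M :: nat
  assumes "c > 0"
  obtains \<mu> :: real where "\<mu> > 0" "\<And>\<epsilon>. 0 < \<epsilon> \<Longrightarrow> \<epsilon> \<le> 1 \<Longrightarrow> \<mu> * \<epsilon> powr (1 / \<mu>) \<le> c * \<epsilon> ^ M"
proof -
  \<comment> \<open>One number must serve as coefficient and as inverse exponent; for
    \<open>\<epsilon> \<le> 1\<close> decreasing it only weakens the bound. The added 1 covers
    \<open>M = 0\<close>.\<close>
  define \<mu> where "\<mu> = min c (1 / (real M + 1))"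
  have \<mu>: "\<mu> > 0" "\<mu> \<le> c" "\<mu> \<le> 1 / (real M + 1)" using assms by (auto simp: \<mu>_def)
  have "real M \<le> 1 / \<mu>"
  proof -
    have "\<mu> * (real M + 1) \<le> 1" using \<mu>(3) by (simp add: le_divide_eq)
    then have "real M + 1 \<le> 1 / \<mu>" using \<mu>(1) by (simp add: le_divide_eq mult.commute)
    then show ?thesis by simp
  qed
  then have "\<mu> * \<epsilon> powr (1 / \<mu>) \<le> c * \<epsilon> ^ M" if "0 < \<epsilon>" "\<epsilon> \<le> 1" for \<epsilon>
  proof -
    have "\<epsilon> powr (1 / \<mu>) \<le> \<epsilon> powr real M" using \<open>real M \<le> 1 / \<mu>\<close> that by (intro powr_mono') auto
    then have "\<epsilon> powr (1 / \<mu>) \<le> \<epsilon> ^ M" using that by (simp add: powr_realpow)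
    then show ?thesis using \<mu> by (intro mult_mono) auto
  qed
  then show ?thesis using that \<mu>(1) by blast
qed

text \<open>The bound \<open>c * \<epsilon> ^ M\<close> is admissible, hence at most the maximum
  \<open>removal_delta\<close>. What is left to check is the empty host graph.\<close>

lemma poly_removal_delta:
  fixes H :: "'a graph"
  assumes H: "simple_graph H" and c: "0 < c" "c \<le> 1"
    and copies: "\<And>\<epsilon> (G :: nat graph). 0 < \<epsilon> \<Longrightarrow> \<epsilon> \<le> 1 \<Longrightarrow> simple_graph G \<Longrightarrow> verts G \<noteq> {} \<Longrightarrow>
      min_degree_at_least G (\<gamma> * real (card (verts G))) \<Longrightarrow>
      contains_edge_disjoint_copies G H (\<epsilon> * real (card (verts G)) ^ 2) \<Longrightarrow>
      c * \<epsilon> ^ M * real (card (verts G)) ^ card (verts H) \<le> real (card (copies H G))"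
  shows "\<exists>\<mu>>0. \<forall>\<epsilon>. 0 < \<epsilon> \<and> \<epsilon> \<le> 1 \<longrightarrow> removal_delta \<epsilon> H \<gamma> \<ge> \<mu> * \<epsilon> powr (1 / \<mu>)"
proof -
  obtain \<mu> :: real where \<mu>: "\<mu> > 0" "\<And>\<epsilon>. 0 < \<epsilon> \<Longrightarrow> \<epsilon> \<le> 1 \<Longrightarrow> \<mu> * \<epsilon> powr (1 / \<mu>) \<le> c * \<epsilon> ^ M"
    using power_ge_mu_powr[OF c(1)] by blast
  have "\<mu> * \<epsilon> powr (1 / \<mu>) \<le> removal_delta \<epsilon> H \<gamma>" if \<epsilon>: "0 < \<epsilon>" "\<epsilon> \<le> 1" for \<epsilon>
  proof -
    have \<epsilon>M: "0 \<le> c * \<epsilon> ^ M" "c * \<epsilon> ^ M \<le> 1"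
      using c \<epsilon> by (auto simp: power_le_one mult_le_one)
    have "removal_admissible \<epsilon> H \<gamma> (c * \<epsilon> ^ M)"
      unfolding removal_admissible_def
    proof (intro conjI allI impI \<epsilon>M)
      fix G :: "nat graph" and n
      assume G: "simple_graph G \<and> card (verts G) = n \<and> min_degree_at_least G (\<gamma> * real n) \<and>
        contains_edge_disjoint_copies G H (\<epsilon> * real n ^ 2)"
      show "c * \<epsilon> ^ M * real n ^ card (verts H) \<le> real (card (copies H G))"
      proof (cases "verts G = {}")
        case False
        then show ?thesis using copies[OF \<epsilon>, of G] G by auto
      next
        case True
        then have n: "n = 0" using G by auto
        show ?thesis
        \<comment> \<open>With \<open>n = 0\<close> the right power is 0 unless \<open>H\<close> is
          empty; then it is 1, and the empty map is the one copy.\<close>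
        proof (cases "verts H = {}")
          case True
          then have "edges H = {}" using H by (fastforce simp: simple_graph_def)
          then have "copies H G = {\<lambda>_. undefined}"
            using True by (auto simp: copies_def graph_hom_def)
          then show ?thesis using True \<epsilon>M by simp
        next
          case False
          then have "card (verts H) > 0" using H by (simp add: simple_graph_def card_gt_0_iff)
          then show ?thesis using n by (simp add: power_0_left)
        qed
      qed
    qed
    then have "c * \<epsilon> ^ M \<le> removal_delta \<epsilon> H \<gamma>" by (rule removal_delta_is_max(2))
    then show ?thesis using \<mu>(2)[OF \<epsilon>] by linarith
  qed
  then show ?thesis using \<mu>(1) by blast
qed

text \<open>For the endpoint density 1, where no larger density in the unit interval is available:
  only the empty graph meets the degree condition.\<close>

lemma no_full_min_degree:
  assumes "simple_graph G" "verts G \<noteq> {}"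
  shows "\<not> min_degree_at_least G (real (card (verts G)))"
proof -
  obtain v where v: "v \<in> verts G" using assms by blast
  have fin: "finite (verts G)" using assms by (simp add: simple_graph_def)
  have "{w \<in> verts G. {v, w} \<in> edges G} \<subseteq> verts G - {v}"
    using simple_graph_edge(3)[OF assms(1)] by auto
  then have "vdegree G v \<le> card (verts G - {v})"
    unfolding vdegree_eq_card_neighbours[OF assms(1) v] using fin by (intro card_mono) auto
  also have "\<dots> < card (verts G)" using v fin by (intro card_Diff1_less)
  finally show ?thesis using v by (auto simp: min_degree_at_least_def not_le)
qed

lemma poly_removal_above_hom_density:
  fixes H :: "'a graph" and F :: "nat graph"
  assumes H: "simple_graph H" and F: "simple_graph F" "\<not> admits_hom H F"
    and thr: "\<And>K :: nat graph. simple_graph K \<Longrightarrow> \<not> admits_hom H K \<Longrightarrow>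
      min_degree_at_least K (\<gamma>0 * real (card (verts K))) \<Longrightarrow> admits_hom K F"
    and \<gamma>: "\<gamma>0 < \<gamma>" "\<gamma> \<le> 1"
  shows "\<exists>\<mu>>0. \<forall>\<epsilon>. 0 < \<epsilon> \<and> \<epsilon> \<le> 1 \<longrightarrow> removal_delta \<epsilon> H \<gamma> \<ge> \<mu> * \<epsilon> powr (1 / \<mu>)"
proof -
  define v where "v = card (verts H)"
  obtain C :: real where C: "C \<ge> 1" and homs:
    "\<And>\<epsilon> (G :: nat graph). 0 < \<epsilon> \<Longrightarrow> \<epsilon> \<le> 1 \<Longrightarrow> simple_graph G \<Longrightarrow> verts G \<noteq> {} \<Longrightarrow>
      min_degree_at_least G (\<gamma> * real (card (verts G))) \<Longrightarrow>
      contains_edge_disjoint_copies G H (\<epsilon> * real (card (verts G)) ^ 2) \<Longrightarrow>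
      ((\<epsilon>\<^sup>2 / C) ^ v / 2) ^ 2 ^ v * real (card (verts G)) ^ v \<le>
      real (card {\<phi> \<in> verts H \<rightarrow>\<^sub>E verts G. graph_hom \<phi> H G})"
    using many_homs[OF H F thr \<gamma>] unfolding v_def by blast
  define c1 where "c1 = (1 / (C ^ v * 2)) ^ 2 ^ v"
  define c where "c = (c1 / (2 * real v ^ 2 + 2)) ^ (v + 1)"
  \<comment> \<open>The factors come from \<open>\<epsilon>\<^sup>2\<close>, the \<open>v\<close>
    vertices of the pattern, the repeated squaring, and the passage from homomorphisms to
    copies.\<close>
  define M where "M = 2 * v * 2 ^ v * (v + 1)"
  have Cv: "C ^ v \<ge> 1" using C by simp
  then have "1 \<le> C ^ v * 2" by linarith
  then have c1: "0 < c1" "c1 \<le> 1" unfolding c1_def using C by (auto intro!: power_le_one)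
  have "c1 / (2 * real v ^ 2 + 2) \<le> 1"
  proof -
    have "c1 \<le> 2 * real v ^ 2 + 2" using c1 zero_le_power2[of "real v"] by linarith
    moreover have "0 < 2 * real v ^ 2 + 2" using zero_le_power2[of "real v"] by linarith
    ultimately show ?thesis by (simp add: divide_le_eq_1)
  qed
  moreover have "0 < c1 / (2 * real v ^ 2 + 2)"
    using c1 zero_le_power2[of "real v"] by (intro divide_pos_pos) linarith+
  ultimately have c: "0 < c" "c \<le> 1"
    unfolding c_def by (simp_all only: zero_less_power power_le_one less_imp_le)
  show ?thesis
  proof (rule poly_removal_delta[OF H c, where M = M])
    fix \<epsilon> :: real and G :: "nat graph"
    assume \<epsilon>: "0 < \<epsilon>" "\<epsilon> \<le> 1" and G: "simple_graph G" "verts G \<noteq> {}"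
      "min_degree_at_least G (\<gamma> * real (card (verts G)))"
      and cont: "contains_edge_disjoint_copies G H (\<epsilon> * real (card (verts G)) ^ 2)"
    have "card (verts G) > 0" using G by (simp add: simple_graph_def card_gt_0_iff)
    then have "\<epsilon> * real (card (verts G)) ^ 2 > 0" using \<epsilon> by simp
    \<comment> \<open>A positive number of edge-disjoint copies supplies the single copy used for
      small \<open>n\<close>.\<close>
    then have ne: "copies H G \<noteq> {}" using cont by (auto simp: contains_edge_disjoint_copies_def)
    define D where "D = ((\<epsilon>\<^sup>2 / C) ^ v / 2) ^ 2 ^ v"
    have D_eq: "D = c1 * \<epsilon> ^ (2 * v * 2 ^ v)"
      by (simp add: D_def c1_def power_divide power_mult_distrib flip: power_mult)
    have "0 < \<epsilon> ^ (2 * v * 2 ^ v)" "\<epsilon> ^ (2 * v * 2 ^ v) \<le> 1" using \<epsilon> by (auto intro: power_le_one)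
    then have D: "0 < D" "D \<le> 1" unfolding D_eq using c1 by (auto intro: mult_le_one)
    have "(D / (2 * real v ^ 2 + 2)) ^ (v + 1) * real (card (verts G)) ^ v \<le> real (card (copies H G))"
      using card_copies_ge[OF H G(1,2) D _ ne] homs[OF \<epsilon> G cont] by (simp add: D_def v_def)
    also have "(D / (2 * real v ^ 2 + 2)) ^ (v + 1) = c * \<epsilon> ^ M"
      unfolding D_eq c_def M_def power_divide power_mult_distrib power_mult by simp
    finally show "c * \<epsilon> ^ M * real (card (verts G)) ^ card (verts H) \<le> real (card (copies H G))"
      unfolding v_def .
  qed
qed

theorem theorem1p3:
  fixes H :: "'a graph"
  assumes "simple_graph H"
  shows "poly_rem_threshold H \<le> hom_threshold (minimal_hom_images H)"
  unfolding hom_threshold_def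
proof (rule Inf_greatest, clarify)
  fix \<gamma>0 :: real and F :: "nat graph"
  assume \<gamma>0: "0 \<le> \<gamma>0" "\<gamma>0 \<le> 1" and F: "simple_graph F" "family_free (minimal_hom_images H) F"
    and hom: "\<forall>(G :: nat graph) n. simple_graph G \<and> card (verts G) = n \<and>
      family_free (minimal_hom_images H) G \<and> min_degree_at_least G (\<gamma>0 * real n) \<longrightarrow> admits_hom G F"
  have le: "poly_rem_threshold H \<le> ereal \<gamma>"
    if "0 \<le> \<gamma>" "\<gamma> \<le> 1"
      "\<exists>\<mu>>0. \<forall>\<epsilon>. 0 < \<epsilon> \<and> \<epsilon> \<le> 1 \<longrightarrow> removal_delta \<epsilon> H \<gamma> \<ge> \<mu> * \<epsilon> powr (1 / \<mu>)" for \<gamma>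
    unfolding poly_rem_threshold_def using that by (intro Inf_lower imageI) simp
  show "poly_rem_threshold H \<le> ereal \<gamma>0"
  proof (cases "\<gamma>0 = 1")
    case True
    \<comment> \<open>At density 1 there is no nonempty host graph, so even the constant bound 1
      holds vacuously.\<close>
    have "\<exists>\<mu>>0. \<forall>\<epsilon>. 0 < \<epsilon> \<and> \<epsilon> \<le> 1 \<longrightarrow> removal_delta \<epsilon> H 1 \<ge> \<mu> * \<epsilon> powr (1 / \<mu>)"
      using no_full_min_degree by (intro poly_removal_delta[OF assms, of 1 1 0]) auto
    then show ?thesis using le[of 1] True by simp
  next
    case False
    have thr: "admits_hom K F" if "simple_graph K" "\<not> admits_hom H K"
      "min_degree_at_least K (\<gamma>0 * real (card (verts K)))" for K :: "nat graph"
      using hom that family_free_minimal_hom_images_iff[OF that(1)] by blast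
    have noF: "\<not> admits_hom H F" using F family_free_minimal_hom_images_iff by blast
    have step: "poly_rem_threshold H \<le> ereal \<gamma>" if "\<gamma>0 < \<gamma>" "\<gamma> \<le> 1" for \<gamma>
      using le[of \<gamma>] poly_removal_above_hom_density[OF assms F(1) noF thr that] that \<gamma>0 by simp
    show ?thesis
    \<comment> \<open>The polynomial bound is known only strictly above \<open>\<gamma>0\<close>;
      letting the density decrease to \<open>\<gamma>0\<close> bounds the infimum.\<close>
    proof (rule dense_ge_bounded[of _ "1::ereal"])
      show "ereal \<gamma>0 < 1" using False \<gamma>0 by (simp add: one_ereal_def)
      fix w assume w: "ereal \<gamma>0 < w" "w < 1"
      then obtain \<gamma> where "w = ereal \<gamma>" by (cases w) auto
      then show "poly_rem_threshold H \<le> w" using step w by (simp add: one_ereal_def)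
    qed
  qed
qed

end
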